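(* Let $t\in\mathbb R\setminus\{0\}$. Let $\phi$ be an $\mathbb H_t^{n\times n}$-valued rational function regular at the origin and at infinity, and let $\phi(x)=D+xC(I_{\mathbb H_t^N}-xA)^{-1}B$ be a minimal realization of $\phi$. Then $\phi$ satisfies $$\phi(x)=-(\phi(1/x))^{\circledast}$$ at those real points $x$ where both sides are defined if and only if there exists an invertible matrix $H\in\mathbb H_t^{N\times N}$ with $H=H^{\circledast}$ such that $$A=H^{-1}(A^{\circledast})^{-1}H,\qquad D+D^{\circledast}=B^{\circledast}HB,\qquad B=AH^{-1}C^{\circledast}.$$ The matrix $H$ is invertible and uniquely determined by the realization.
   Context: For real $t\neq 0$, $\mathbb H_t$ is the real associative algebra of elements $q=a+bj_t$ with $a,b\in\mathbb C$, where $\mathbb C\subset\mathbb H_t$, $j_t^2=t$ and $j_t a=\overline a\, j_t$ for $a\in\mathbb C$. For $q=a+bj_t$ set $q^{\circledast}=\overline a-bj_t$; for a matrix $M=(m_{jk})$ over $\mathbb H_t$, $M^{\circledast}$ is the matrix whose $(j,k)$ entry is $m_{kj}^{\circledast}$. $I_{\mathbb H_t^N}$ is the identity matrix in $\mathbb H_t^{N\times N}$. The variable $x$ is real. An $\mathbb H_t^{n\times n}$-valued function $\phi$ of the real variable $x$, defined at $x=0$ (regular at the origin), is rational if it can be written as $\phi(x)=D+xC(I_{\mathbb H_t^N}-xA)^{-1}B$ with $D=\phi(0)$ and $(C,A,B)\in\mathbb H_t^{n\times N}\times\mathbb H_t^{N\times N}\times\mathbb H_t^{N\times n}$ (a realization).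 It is regular at infinity if $x\mapsto\phi(1/x)$ extends analytically to a neighborhood of $x=0$. The pair $(C,A)$ is observable if for $h\in\mathbb H_t^N$: $C(I_{\mathbb H_t^N}-xA)^{-1}h=0$ for all $x$ in some interval $(-\varepsilon,\varepsilon)$ if and only if $h=0$. The pair $(A,B)$ is controllable if for $h\in\mathbb H_t^{1\times N}$: $hA^kB=0$ for all $k=0,1,2,\ldots$ if and only if $h=0$. The realization is minimal if $(C,A)$ is observable and $(A,B)$ is controllable. *)

theory Defs
  imports "HOL-Analysis.Product_Vector" "Jordan_Normal_Form.Matrix"
begin

text \<open>The pair \<open>(a, b)\<close> stands for \<open>a + b j\<^sub>t\<close>. Addition and real scaling are those of
  the product type and do not depend on \<open>t\<close>; the multiplication does, so \<open>t\<close> is an explicit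
  argument of everything that involves products.\<close>

type_synonym hq = "complex \<times> complex"
type_synonym hmat = "hq mat"

definition hq_of_complex :: "complex \<Rightarrow> hq" where
  "hq_of_complex a = (a, 0)"

definition hq_j :: hq where
  "hq_j = (0, 1)"

text \<open>From \<open>j\<^sub>t d = cnj d j\<^sub>t\<close> and \<open>j\<^sub>t\<^sup>2 = t\<close>:
  \<open>(a + b j\<^sub>t) (c + d j\<^sub>t) = (a c + t b (cnj d)) + (a d + b (cnj c)) j\<^sub>t\<close>.\<close>

definition hq_mult :: "real \<Rightarrow> hq \<Rightarrow> hq \<Rightarrow> hq" where
  "hq_mult t p q =
     (fst p * fst q + of_real t * snd p * cnj (snd q), fst p * snd q + snd p * cnj (fst q))"

lemma hq_decompose: "p = hq_of_complex (fst p) + hq_mult t (hq_of_complex (snd p)) hq_j"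
  by (simp add: hq_of_complex_def hq_j_def hq_mult_def)

lemma hq_mult_of_complex:
  "hq_mult t (hq_of_complex a) (hq_of_complex b) = hq_of_complex (a * b)"
  by (simp add: hq_of_complex_def hq_mult_def)

lemma hq_j_square: "hq_mult t hq_j hq_j = hq_of_complex (of_real t)"
  by (simp add: hq_of_complex_def hq_j_def hq_mult_def)

lemma hq_j_commute:
  "hq_mult t hq_j (hq_of_complex a) = hq_mult t (hq_of_complex (cnj a)) hq_j"
  by (simp add: hq_of_complex_def hq_j_def hq_mult_def)

lemma hq_mult_assoc: "hq_mult t (hq_mult t p q) r = hq_mult t p (hq_mult t q r)"
  by (simp add: hq_mult_def algebra_simps)

lemma hq_mult_add_left: "hq_mult t (p + q) r = hq_mult t p r + hq_mult t q r"
  and hq_mult_add_right: "hq_mult t r (p + q) = hq_mult t r p + hq_mult t r q"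
  by (simp_all add: hq_mult_def algebra_simps)

lemma hq_mult_scaleR_left: "hq_mult t (x *\<^sub>R p) q = x *\<^sub>R hq_mult t p q"
  and hq_mult_scaleR_right: "hq_mult t p (x *\<^sub>R q) = x *\<^sub>R hq_mult t p q"
  by (simp_all add: hq_mult_def scaleR_conv_of_real algebra_simps)

definition hq_adj :: "hq \<Rightarrow> hq" where
  "hq_adj q = (cnj (fst q), - snd q)"

definition hmat_adj :: "hmat \<Rightarrow> hmat" ("_\<^sup>\<circledast>" [1000] 1000) where
  "M\<^sup>\<circledast> = map_mat hq_adj (transpose_mat M)"

definition hmat_one :: "nat \<Rightarrow> hmat" where
  "hmat_one N = mat N N (\<lambda>(i, j). if i = j then hq_of_complex 1 else 0)"

definition hmat_scaleR :: "real \<Rightarrow> hmat \<Rightarrow> hmat" where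
  "hmat_scaleR x M = map_mat (\<lambda>q. x *\<^sub>R q) M"

definition hmat_mult :: "hmat \<Rightarrow> real \<Rightarrow> hmat \<Rightarrow> hmat" ("(_ \<odot>\<^bsub>_\<^esub>/ _)" [70, 0, 71] 70) where
  "P \<odot>\<^bsub>t\<^esub> Q = mat (dim_row P) (dim_col Q)
     (\<lambda>(i, j). \<Sum>k<dim_col P. hq_mult t (P $$ (i, k)) (Q $$ (k, j)))"

primrec hmat_pow :: "real \<Rightarrow> hmat \<Rightarrow> nat \<Rightarrow> hmat" where
  "hmat_pow t M 0 = hmat_one (dim_row M)"
| "hmat_pow t M (Suc k) = hmat_pow t M k \<odot>\<^bsub>t\<^esub> M"

definition hmat_is_inverse :: "real \<Rightarrow> hmat \<Rightarrow> hmat \<Rightarrow> bool" where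
  "hmat_is_inverse t M X \<longleftrightarrow>
     M \<in> carrier_mat (dim_row M) (dim_row M) \<and> X \<in> carrier_mat (dim_row M) (dim_row M) \<and>
     M \<odot>\<^bsub>t\<^esub> X = hmat_one (dim_row M) \<and> X \<odot>\<^bsub>t\<^esub> M = hmat_one (dim_row M)"

definition hmat_invertible :: "real \<Rightarrow> hmat \<Rightarrow> bool" where
  "hmat_invertible t M \<longleftrightarrow> (\<exists>X. hmat_is_inverse t M X)"

text \<open>Unspecified if \<open>M\<close> is not invertible.\<close>

definition hmat_inv :: "real \<Rightarrow> hmat \<Rightarrow> hmat" where
  "hmat_inv t M = (THE X. hmat_is_inverse t M X)"

abbreviation hpencil :: "hmat \<Rightarrow> real \<Rightarrow> hmat" where
  "hpencil A x \<equiv> hmat_one (dim_row A) - hmat_scaleR x A"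

text \<open>Functions of the real variable are partial functions, with \<open>None\<close> at the points where
  they are not defined. A realization defines its function exactly where \<open>I - x A\<close> is
  invertible; this always includes \<open>x = 0\<close>, where the value is \<open>D\<close>.\<close>

definition transfer_function ::
    "real \<Rightarrow> hmat \<Rightarrow> hmat \<Rightarrow> hmat \<Rightarrow> hmat \<Rightarrow> real \<Rightarrow> hmat option" where
  "transfer_function t A B C D x =
     (if hmat_invertible t (hpencil A x)
      then Some (D + hmat_scaleR x (C \<odot>\<^bsub>t\<^esub> hmat_inv t (hpencil A x) \<odot>\<^bsub>t\<^esub> B))
      else None)"

definition is_realization ::
    "real \<Rightarrow> nat \<Rightarrow> nat \<Rightarrow> (real \<Rightarrow> hmat option) \<Rightarrow> hmat \<Rightarrow> hmat \<Rightarrow> hmat \<Rightarrow> hmat \<Rightarrow> bool" where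
  "is_realization t n N \<phi> A B C D \<longleftrightarrow>
     A \<in> carrier_mat N N \<and> B \<in> carrier_mat N n \<and> C \<in> carrier_mat n N \<and> D \<in> carrier_mat n n \<and>
     \<phi> 0 = Some D \<and> \<phi> = transfer_function t A B C D"

definition rational_at_origin :: "real \<Rightarrow> nat \<Rightarrow> (real \<Rightarrow> hmat option) \<Rightarrow> bool" where
  "rational_at_origin t n \<phi> \<longleftrightarrow> (\<exists>N A B C D. is_realization t n N \<phi> A B C D)"

text \<open>The convergent power series is the analytic extension of \<open>\<lambda>x. \<phi> (1 / x)\<close> to
  \<open>{-\<epsilon><..<\<epsilon>}\<close>; its coefficients \<open>c k i j\<close> are arbitrary elements of the algebra.\<close>

definition regular_at_infinity :: "nat \<Rightarrow> (real \<Rightarrow> hmat option) \<Rightarrow> bool" where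
  "regular_at_infinity n \<phi> \<longleftrightarrow>
     (\<exists>\<epsilon>>0. \<exists>c :: nat \<Rightarrow> nat \<Rightarrow> nat \<Rightarrow> hq. \<forall>x. 0 < \<bar>x\<bar> \<and> \<bar>x\<bar> < \<epsilon> \<longrightarrow>
        (\<exists>Y. \<phi> (1 / x) = Some Y \<and>
          (\<forall>i<n. \<forall>j<n. (\<lambda>k. (x ^ k) *\<^sub>R c k i j) sums (Y $$ (i, j)))))"

definition observable :: "real \<Rightarrow> nat \<Rightarrow> nat \<Rightarrow> hmat \<Rightarrow> hmat \<Rightarrow> bool" where
  "observable t n N C A \<longleftrightarrow>
     (\<forall>h \<in> carrier_mat N 1.
        (\<exists>\<epsilon>>0. \<forall>x\<in>{-\<epsilon><..<\<epsilon>}. hmat_invertible t (hpencil A x) \<and>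
           C \<odot>\<^bsub>t\<^esub> hmat_inv t (hpencil A x) \<odot>\<^bsub>t\<^esub> h = 0\<^sub>m n 1)
        \<longleftrightarrow> h = 0\<^sub>m N 1)"

definition controllable :: "real \<Rightarrow> nat \<Rightarrow> nat \<Rightarrow> hmat \<Rightarrow> hmat \<Rightarrow> bool" where
  "controllable t n N A B \<longleftrightarrow>
     (\<forall>h \<in> carrier_mat 1 N.
        (\<forall>k. h \<odot>\<^bsub>t\<^esub> hmat_pow t A k \<odot>\<^bsub>t\<^esub> B = 0\<^sub>m 1 n) \<longleftrightarrow> h = 0\<^sub>m 1 N)"

definition is_minimal_realization ::
    "real \<Rightarrow> nat \<Rightarrow> nat \<Rightarrow> (real \<Rightarrow> hmat option) \<Rightarrow> hmat \<Rightarrow> hmat \<Rightarrow> hmat \<Rightarrow> hmat \<Rightarrow> bool" where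
  "is_minimal_realization t n N \<phi> A B C D \<longleftrightarrow>
     is_realization t n N \<phi> A B C D \<and> observable t n N C A \<and> controllable t n N A B"

text \<open>\<open>hmat_inv t (A\<^sup>\<circledast>)\<close> is used below only for the state matrix of a minimal realization
  of a function regular at infinity; that matrix is invertible, and so is its adjoint.\<close>

definition associated_matrix ::
    "real \<Rightarrow> nat \<Rightarrow> hmat \<Rightarrow> hmat \<Rightarrow> hmat \<Rightarrow> hmat \<Rightarrow> hmat \<Rightarrow> bool" where
  "associated_matrix t N A B C D H \<longleftrightarrow>
     H \<in> carrier_mat N N \<and> hmat_invertible t H \<and> H = H\<^sup>\<circledast> \<and>
     A = hmat_inv t H \<odot>\<^bsub>t\<^esub> hmat_inv t (A\<^sup>\<circledast>) \<odot>\<^bsub>t\<^esub> H \<and>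
     D + D\<^sup>\<circledast> = B\<^sup>\<circledast> \<odot>\<^bsub>t\<^esub> H \<odot>\<^bsub>t\<^esub> B \<and>
     B = A \<odot>\<^bsub>t\<^esub> hmat_inv t H \<odot>\<^bsub>t\<^esub> C\<^sup>\<circledast>"

end

theory Submission
  imports Defs "Jordan_Normal_Form.Determinant"
begin

text \<open>
  Two minimal realizations of one function differ by a unique change of coordinates in the state
  space, and \<open>H\<close> is such a change of coordinates. Regularity at infinity makes \<open>A\<close> invertible
  (\<open>state_matrix_invertible\<close>); let \<open>E\<close> be its inverse. Since \<open>I - A / x = - (1 / x) A (I - x E)\<close>,
  one has \<open>\<phi> (1 / x) = D - C (I - x E)\<^sup>-\<^sup>1 E B\<close>,
  so \<open>- (\<phi> (1 / x))\<^sup>\<circledast>\<close> is the transfer function with state matrix \<open>E\<^sup>\<circledast>\<close>, input matrix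
  \<open>E\<^sup>\<circledast> C\<^sup>\<circledast>\<close>, output matrix \<open>B\<^sup>\<circledast> E\<^sup>\<circledast>\<close> and value \<open>- D\<^sup>\<circledast> + (C E B)\<^sup>\<circledast>\<close> at the origin. Comparing
  expansions at the origin, the symmetry gives \<open>D + D\<^sup>\<circledast> = (C E B)\<^sup>\<circledast>\<close> and the equality of the moments
  of this system with the moments \<open>C A\<^sup>k B\<close> of the given one (\<open>moments_of_symmetric_function\<close>). Equal moments
  yield a matrix \<open>S\<close> with \<open>S A = E\<^sup>\<circledast> S\<close>, \<open>S B = E\<^sup>\<circledast> C\<^sup>\<circledast>\<close> and \<open>B\<^sup>\<circledast> E\<^sup>\<circledast> S = C\<close>
  (\<open>intertwiner_exists\<close>). The adjoints of these equations say that \<open>S\<^sup>\<circledast>\<close> satisfies them too, so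
  \<open>S = S\<^sup>\<circledast>\<close> by \<open>intertwiner_unique\<close>; and together with \<open>D + D\<^sup>\<circledast> = (C E B)\<^sup>\<circledast>\<close> they are
  equivalent to the equations required of \<open>H\<close> (\<open>associated_matrix_iff\<close>). The same uniqueness shows that \<open>H\<close> is
  determined by the realization. Conversely, if \<open>H\<close> exists, then
  \<open>\<phi> x = B\<^sup>\<circledast> H (I - x A)\<^sup>-\<^sup>1 B - D\<^sup>\<circledast>\<close>, and \<open>- (\<phi> (1 / x))\<^sup>\<circledast>\<close> is the same matrix
  (\<open>associated_matrix_imp_symmetric\<close>).

  For \<open>t > 0\<close> the algebra has zero divisors, so there are no dimensions or ranks over it. Finite
  dimension over the reals replaces them, and it enters only through
  \<open>annihilating_polynomial\<close>: a square matrix is a root of a nonzero real polynomial. If moreover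
  it can be cancelled from products with its own polynomials, then it is invertible and its
  inverse is one of these polynomials (\<open>inverse_if_no_nilpotent_part\<close>). This criterion provides
  the inverses of \<open>A\<close>, of \<open>I - x A\<close> near the origin, of \<open>H\<close>, and of the Gram matrix
  \<open>G = \<Sum> (A\<^sup>k B) (A\<^sup>k B)\<^sup>\<sigma>\<close>, where \<open>\<sigma>\<close> is a positive involution. The last one gives the
  intertwiner in closed form, as \<open>(\<Sum> (A'\<^sup>k B') (A\<^sup>k B)\<^sup>\<sigma>) G\<^sup>-\<^sup>1\<close> for a second system
  \<open>(C', A', B')\<close>.
\<close>

section \<open>Matrices over the algebra\<close>

lemma hq_mult_zero [simp]: "hq_mult t 0 q = 0" "hq_mult t q 0 = 0"
  by (simp_all add: hq_mult_def zero_prod_def)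

lemma hq_mult_one [simp]:
  "hq_mult t (hq_of_complex 1) q = q" "hq_mult t q (hq_of_complex 1) = q"
  by (simp_all add: hq_mult_def hq_of_complex_def)

lemma hq_mult_diff:
  "hq_mult t (p - q) r = hq_mult t p r - hq_mult t q r"
  "hq_mult t r (p - q) = hq_mult t r p - hq_mult t r q"
  by (simp_all add: hq_mult_def algebra_simps)

lemma hq_mult_sum_left: "hq_mult t (sum f S) q = (\<Sum>k\<in>S. hq_mult t (f k) q)"
  by (induction S rule: infinite_finite_induct) (simp_all add: hq_mult_add_left)

lemma hq_mult_sum_right: "hq_mult t q (sum f S) = (\<Sum>k\<in>S. hq_mult t q (f k))"
  by (induction S rule: infinite_finite_induct) (simp_all add: hq_mult_add_right)

lemma hq_adj_simps [simp]:
  "hq_adj (hq_adj q) = q" "hq_adj 0 = 0" "hq_adj (hq_of_complex 1) = hq_of_complex 1"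
  "hq_adj (p + q) = hq_adj p + hq_adj q" "hq_adj (p - q) = hq_adj p - hq_adj q"
  "hq_adj (x *\<^sub>R q) = x *\<^sub>R hq_adj q"
  by (simp_all add: hq_adj_def hq_of_complex_def prod_eq_iff scaleR_conv_of_real)

lemma hq_adj_mult: "hq_adj (hq_mult t p q) = hq_mult t (hq_adj q) (hq_adj p)"
  by (simp add: hq_adj_def hq_mult_def)

lemma hq_adj_sum: "hq_adj (sum f S) = (\<Sum>k\<in>S. hq_adj (f k))"
  by (induction S rule: infinite_finite_induct) simp_all

lemma hmat_dims [simp]:
  "dim_row (P \<odot>\<^bsub>t\<^esub> Q) = dim_row P" "dim_col (P \<odot>\<^bsub>t\<^esub> Q) = dim_col Q"
  "dim_row (M\<^sup>\<circledast>) = dim_col M" "dim_col (M\<^sup>\<circledast>) = dim_row M"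
  "dim_row (hmat_one N) = N" "dim_col (hmat_one N) = N"
  "dim_row (hmat_scaleR x M) = dim_row M" "dim_col (hmat_scaleR x M) = dim_col M"
  by (simp_all add: hmat_mult_def hmat_adj_def hmat_one_def hmat_scaleR_def)

lemma hmat_index [simp]:
  "i < dim_row P \<Longrightarrow> j < dim_col Q \<Longrightarrow>
     (P \<odot>\<^bsub>t\<^esub> Q) $$ (i, j) = (\<Sum>k<dim_col P. hq_mult t (P $$ (i, k)) (Q $$ (k, j)))"
  "i < dim_col M \<Longrightarrow> j < dim_row M \<Longrightarrow> M\<^sup>\<circledast> $$ (i, j) = hq_adj (M $$ (j, i))"
  "i < N \<Longrightarrow> j < N \<Longrightarrow> hmat_one N $$ (i, j) = (if i = j then hq_of_complex 1 else 0)"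
  "i < dim_row M \<Longrightarrow> j < dim_col M \<Longrightarrow> hmat_scaleR x M $$ (i, j) = x *\<^sub>R M $$ (i, j)"
  by (simp_all add: hmat_mult_def hmat_adj_def hmat_one_def hmat_scaleR_def)

text \<open>As equivalences these rules spare the simplifier a guess of the inner dimension of a product.\<close>

lemma hmat_carrier_iff [simp]:
  "P \<odot>\<^bsub>t\<^esub> Q \<in> carrier_mat a b \<longleftrightarrow> dim_row P = a \<and> dim_col Q = b"
  "M\<^sup>\<circledast> \<in> carrier_mat a b \<longleftrightarrow> dim_col M = a \<and> dim_row M = b"
  "hmat_one N \<in> carrier_mat N N"
  "hmat_scaleR x M \<in> carrier_mat a b \<longleftrightarrow> dim_row M = a \<and> dim_col M = b"
  "P - M \<in> carrier_mat a b \<longleftrightarrow> dim_row M = a \<and> dim_col M = b"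
  unfolding carrier_mat_def by simp_all

lemma hmat_diff_self [simp]: "M - M = 0\<^sub>m (dim_row M) (dim_col M)" for M :: hmat
  by (rule eq_matI) simp_all

lemma hmat_diff_eq_0:
  assumes "P - Q = (0\<^sub>m a b :: hmat)" "P \<in> carrier_mat a b" "Q \<in> carrier_mat a b"
  shows "P = Q"
proof (rule eq_matI)
  fix i j assume ij: "i < dim_row Q" "j < dim_col Q"
  have "(P - Q) $$ (i, j) = 0" using assms ij by simp
  then show "P $$ (i, j) = Q $$ (i, j)" using ij by simp
qed (use assms in simp_all)

lemma hmat_mult_assoc:
  assumes "dim_col P = dim_row Q"
  shows "(P \<odot>\<^bsub>t\<^esub> Q) \<odot>\<^bsub>t\<^esub> R = P \<odot>\<^bsub>t\<^esub> (Q \<odot>\<^bsub>t\<^esub> R)"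
proof (rule eq_matI)
  fix i j assume "i < dim_row (P \<odot>\<^bsub>t\<^esub> (Q \<odot>\<^bsub>t\<^esub> R))" "j < dim_col (P \<odot>\<^bsub>t\<^esub> (Q \<odot>\<^bsub>t\<^esub> R))"
  then have ij: "i < dim_row P" "j < dim_col R" by simp_all
  have "((P \<odot>\<^bsub>t\<^esub> Q) \<odot>\<^bsub>t\<^esub> R) $$ (i, j) = (\<Sum>l<dim_col Q. \<Sum>k<dim_col P.
      hq_mult t (hq_mult t (P $$ (i, k)) (Q $$ (k, l))) (R $$ (l, j)))"
    using ij by (simp add: hq_mult_sum_left)
  also have "\<dots> = (\<Sum>k<dim_col P. \<Sum>l<dim_col Q.
      hq_mult t (hq_mult t (P $$ (i, k)) (Q $$ (k, l))) (R $$ (l, j)))"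
    by (rule sum.swap)
  also have "\<dots> = (P \<odot>\<^bsub>t\<^esub> (Q \<odot>\<^bsub>t\<^esub> R)) $$ (i, j)"
    using ij assms by (simp add: hq_mult_sum_right hq_mult_assoc)
  finally show "((P \<odot>\<^bsub>t\<^esub> Q) \<odot>\<^bsub>t\<^esub> R) $$ (i, j) = (P \<odot>\<^bsub>t\<^esub> (Q \<odot>\<^bsub>t\<^esub> R)) $$ (i, j)" .
qed simp_all

lemma hmat_mult_one_left [simp]: "dim_row M = N \<Longrightarrow> hmat_one N \<odot>\<^bsub>t\<^esub> M = M"
proof (rule eq_matI)
  fix i j assume *: "dim_row M = N" "i < dim_row M" "j < dim_col M"
  have "(hmat_one N \<odot>\<^bsub>t\<^esub> M) $$ (i, j) =
      (\<Sum>k<N. hq_mult t (hmat_one N $$ (i, k)) (M $$ (k, j)))"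
    using * by (simp del: hmat_index(3))
  also have "\<dots> = (\<Sum>k<N. if i = k then M $$ (k, j) else 0)"
    using * by (intro sum.cong) auto
  finally have "(hmat_one N \<odot>\<^bsub>t\<^esub> M) $$ (i, j) = (\<Sum>k<N. if i = k then M $$ (k, j) else 0)" .
  then show "(hmat_one N \<odot>\<^bsub>t\<^esub> M) $$ (i, j) = M $$ (i, j)"
    using * by simp
qed simp_all

lemma hmat_mult_one_right [simp]: "dim_col M = N \<Longrightarrow> M \<odot>\<^bsub>t\<^esub> hmat_one N = M"
proof (rule eq_matI)
  fix i j assume *: "dim_col M = N" "i < dim_row M" "j < dim_col M"
  have "(M \<odot>\<^bsub>t\<^esub> hmat_one N) $$ (i, j) =
      (\<Sum>k<N. hq_mult t (M $$ (i, k)) (hmat_one N $$ (k, j)))"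
    using * by (simp del: hmat_index(3))
  also have "\<dots> = (\<Sum>k<N. if j = k then M $$ (i, k) else 0)"
    using * by (intro sum.cong) auto
  finally have "(M \<odot>\<^bsub>t\<^esub> hmat_one N) $$ (i, j) = (\<Sum>k<N. if j = k then M $$ (i, k) else 0)" .
  then show "(M \<odot>\<^bsub>t\<^esub> hmat_one N) $$ (i, j) = M $$ (i, j)"
    using * by simp
qed simp_all

lemma hmat_mult_zero_left [simp]: "0\<^sub>m a b \<odot>\<^bsub>t\<^esub> M = 0\<^sub>m a (dim_col M)"
  by (rule eq_matI) simp_all

lemma hmat_mult_zero_right [simp]: "dim_col M = a \<Longrightarrow> M \<odot>\<^bsub>t\<^esub> 0\<^sub>m a b = 0\<^sub>m (dim_row M) b"
  by (rule eq_matI) simp_all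

lemma hmat_mult_add_left:
  "dim_row P = dim_row Q \<Longrightarrow> dim_col P = dim_col Q \<Longrightarrow> (P + Q) \<odot>\<^bsub>t\<^esub> R = P \<odot>\<^bsub>t\<^esub> R + Q \<odot>\<^bsub>t\<^esub> R"
  by (rule eq_matI) (simp_all add: hq_mult_add_left sum.distrib)

lemma hmat_mult_add_right:
  "dim_row P = dim_row Q \<Longrightarrow> dim_col P = dim_col Q \<Longrightarrow> dim_col R = dim_row Q \<Longrightarrow>
     R \<odot>\<^bsub>t\<^esub> (P + Q) = R \<odot>\<^bsub>t\<^esub> P + R \<odot>\<^bsub>t\<^esub> Q"
  by (rule eq_matI) (simp_all add: hq_mult_add_right sum.distrib)

lemma hmat_mult_diff_left:
  "dim_row P = dim_row Q \<Longrightarrow> dim_col P = dim_col Q \<Longrightarrow> (P - Q) \<odot>\<^bsub>t\<^esub> R = P \<odot>\<^bsub>t\<^esub> R - Q \<odot>\<^bsub>t\<^esub> R"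
  by (rule eq_matI) (simp_all add: hq_mult_diff sum_subtractf)

lemma hmat_mult_diff_right:
  "dim_row P = dim_row Q \<Longrightarrow> dim_col P = dim_col Q \<Longrightarrow> dim_col R = dim_row Q \<Longrightarrow>
     R \<odot>\<^bsub>t\<^esub> (P - Q) = R \<odot>\<^bsub>t\<^esub> P - R \<odot>\<^bsub>t\<^esub> Q"
  by (rule eq_matI) (simp_all add: hq_mult_diff sum_subtractf)

lemma hmat_mult_scaleR_left: "hmat_scaleR x P \<odot>\<^bsub>t\<^esub> Q = hmat_scaleR x (P \<odot>\<^bsub>t\<^esub> Q)"
  by (rule eq_matI) (simp_all add: hq_mult_scaleR_left scaleR_sum_right)

lemma hmat_mult_scaleR_right:
  "dim_col P = dim_row Q \<Longrightarrow> P \<odot>\<^bsub>t\<^esub> hmat_scaleR x Q = hmat_scaleR x (P \<odot>\<^bsub>t\<^esub> Q)"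
  by (rule eq_matI) (simp_all add: hq_mult_scaleR_right scaleR_sum_right)

lemma hmat_scaleR_simps [simp]:
  "hmat_scaleR x (hmat_scaleR y M) = hmat_scaleR (x * y) M"
  "hmat_scaleR 1 M = M"
  "hmat_scaleR 0 M = 0\<^sub>m (dim_row M) (dim_col M)"
  "hmat_scaleR x (0\<^sub>m a b) = 0\<^sub>m a b"
  by (rule eq_matI; simp)+

lemmas hmat_mult_simps =
  hmat_mult_assoc hmat_mult_add_left hmat_mult_add_right hmat_mult_diff_left hmat_mult_diff_right
  hmat_mult_scaleR_left hmat_mult_scaleR_right

lemma hmat_adj_adj [simp]: "(M\<^sup>\<circledast>)\<^sup>\<circledast> = M"
  by (rule eq_matI) simp_all

lemma hmat_adj_mult: "dim_col P = dim_row Q \<Longrightarrow> (P \<odot>\<^bsub>t\<^esub> Q)\<^sup>\<circledast> = Q\<^sup>\<circledast> \<odot>\<^bsub>t\<^esub> P\<^sup>\<circledast>"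
  by (rule eq_matI) (simp_all add: hq_adj_sum hq_adj_mult)

lemma hmat_adj_simps [simp]:
  "(hmat_one N)\<^sup>\<circledast> = hmat_one N" "(0\<^sub>m a b :: hmat)\<^sup>\<circledast> = 0\<^sub>m b a"
  "(hmat_scaleR x M)\<^sup>\<circledast> = hmat_scaleR x (M\<^sup>\<circledast>)"
  by (rule eq_matI; simp)+

lemma hmat_adj_add:
  "dim_row P = dim_row Q \<Longrightarrow> dim_col P = dim_col Q \<Longrightarrow> (P + Q :: hmat)\<^sup>\<circledast> = P\<^sup>\<circledast> + Q\<^sup>\<circledast>"
  by (rule eq_matI) simp_all

lemma hmat_adj_diff:
  "dim_row P = dim_row Q \<Longrightarrow> dim_col P = dim_col Q \<Longrightarrow> (P - Q :: hmat)\<^sup>\<circledast> = P\<^sup>\<circledast> - Q\<^sup>\<circledast>"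
  by (rule eq_matI) simp_all

lemma hmat_is_inverseI:
  "M \<in> carrier_mat N N \<Longrightarrow> X \<in> carrier_mat N N \<Longrightarrow> M \<odot>\<^bsub>t\<^esub> X = hmat_one N \<Longrightarrow>
     X \<odot>\<^bsub>t\<^esub> M = hmat_one N \<Longrightarrow> hmat_is_inverse t M X"
  unfolding hmat_is_inverse_def by (metis carrier_matD(1))

lemma hmat_is_inverseD:
  assumes "hmat_is_inverse t M X" "M \<in> carrier_mat N N'"
  shows "X \<in> carrier_mat N N" "M \<odot>\<^bsub>t\<^esub> X = hmat_one N" "X \<odot>\<^bsub>t\<^esub> M = hmat_one N"
  using assms unfolding hmat_is_inverse_def by (metis carrier_matD(1))+

lemma hmat_left_right_inverse_eq:
  assumes "M \<in> carrier_mat N N" "X \<in> carrier_mat N N" "Y \<in> carrier_mat N N"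
    "X \<odot>\<^bsub>t\<^esub> M = hmat_one N" "M \<odot>\<^bsub>t\<^esub> Y = hmat_one N"
  shows "X = Y"
proof -
  have "X \<odot>\<^bsub>t\<^esub> (M \<odot>\<^bsub>t\<^esub> Y) = (X \<odot>\<^bsub>t\<^esub> M) \<odot>\<^bsub>t\<^esub> Y"
    using assms(1-3) by (subst hmat_mult_assoc) simp_all
  then show ?thesis using assms by simp
qed

lemma hmat_inv_eqI:
  assumes "hmat_is_inverse t M X"
  shows "hmat_inv t M = X"
  unfolding hmat_inv_def
proof (rule the_equality)
  fix Y assume "hmat_is_inverse t M Y"
  with assms show "Y = X"
    unfolding hmat_is_inverse_def by (blast intro: hmat_left_right_inverse_eq)
qed (rule assms)

lemma hmat_is_inverseE:
  assumes "hmat_is_inverse t M X"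
  obtains N where "M \<in> carrier_mat N N" "X \<in> carrier_mat N N"
    "M \<odot>\<^bsub>t\<^esub> X = hmat_one N" "X \<odot>\<^bsub>t\<^esub> M = hmat_one N"
  using assms unfolding hmat_is_inverse_def by blast

lemma hmat_is_inverse_adj:
  assumes "hmat_is_inverse t M X"
  shows "hmat_is_inverse t (M\<^sup>\<circledast>) (X\<^sup>\<circledast>)"
  using assms
proof (rule hmat_is_inverseE)
  fix N assume *: "M \<in> carrier_mat N N" "X \<in> carrier_mat N N"
    "M \<odot>\<^bsub>t\<^esub> X = hmat_one N" "X \<odot>\<^bsub>t\<^esub> M = hmat_one N"
  then show ?thesis
    by (intro hmat_is_inverseI[of _ N]) (simp_all add: hmat_adj_mult[symmetric])
qed

lemma hmat_pow_dims [simp]: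
  "dim_row (hmat_pow t M k) = dim_row M"
  "dim_row M = dim_col M \<Longrightarrow> dim_col (hmat_pow t M k) = dim_row M"
  by (induction k) simp_all

lemma hmat_pow_carrier [simp]: "M \<in> carrier_mat N N \<Longrightarrow> hmat_pow t M k \<in> carrier_mat N N"
  by (rule carrier_matI) simp_all

lemma hmat_pow_Suc_left:
  assumes "M \<in> carrier_mat N N"
  shows "hmat_pow t M (Suc k) = M \<odot>\<^bsub>t\<^esub> hmat_pow t M k"
proof (induction k)
  case (Suc k)
  have "hmat_pow t M (Suc (Suc k)) = (M \<odot>\<^bsub>t\<^esub> hmat_pow t M k) \<odot>\<^bsub>t\<^esub> M"
    using Suc by simp
  also have "\<dots> = M \<odot>\<^bsub>t\<^esub> hmat_pow t M (Suc k)"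
    using assms by (subst hmat_mult_assoc) simp_all
  finally show ?case .
qed (use assms in simp)

lemma hmat_pow_add:
  assumes "M \<in> carrier_mat N N"
  shows "hmat_pow t M (k + l) = hmat_pow t M k \<odot>\<^bsub>t\<^esub> hmat_pow t M l"
proof (induction l)
  case (Suc l)
  have "hmat_pow t M (k + Suc l) = (hmat_pow t M k \<odot>\<^bsub>t\<^esub> hmat_pow t M l) \<odot>\<^bsub>t\<^esub> M"
    using Suc by simp
  also have "\<dots> = hmat_pow t M k \<odot>\<^bsub>t\<^esub> hmat_pow t M (Suc l)"
    using assms by (subst hmat_mult_assoc) simp_all
  finally show ?case .
qed (use assms in simp)

lemma hmat_pow_adj:
  assumes "M \<in> carrier_mat N N"
  shows "(hmat_pow t M k)\<^sup>\<circledast> = hmat_pow t (M\<^sup>\<circledast>) k"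
proof (induction k)
  case (Suc k)
  have "(hmat_pow t M (Suc k))\<^sup>\<circledast> = M\<^sup>\<circledast> \<odot>\<^bsub>t\<^esub> (hmat_pow t M k)\<^sup>\<circledast>"
    using assms by (simp add: hmat_adj_mult)
  also have "\<dots> = hmat_pow t (M\<^sup>\<circledast>) (Suc k)"
    using Suc assms by (subst hmat_pow_Suc_left[of _ N]) simp_all
  finally show ?case .
qed (use assms in simp)

section \<open>Annihilating polynomials and inverses\<close>

text \<open>Evaluation of a real polynomial at a matrix by Horner's rule. The constant coefficient is the
  head of the list, and it decides invertibility; the leading coefficient is the last element,
  and it decides which power of the matrix is a combination of lower ones.\<close>

primrec hpoly :: "real \<Rightarrow> hmat \<Rightarrow> real list \<Rightarrow> hmat" where
  "hpoly t A [] = 0\<^sub>m (dim_row A) (dim_row A)"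
| "hpoly t A (c # cs) = hmat_scaleR c (hmat_one (dim_row A)) + A \<odot>\<^bsub>t\<^esub> hpoly t A cs"

lemma hpoly_carrier [simp]: "A \<in> carrier_mat N N \<Longrightarrow> hpoly t A cs \<in> carrier_mat N N"
  by (induction cs) auto

lemma hpoly_dims [simp]:
  assumes "A \<in> carrier_mat N N"
  shows "dim_row (hpoly t A cs) = N" "dim_col (hpoly t A cs) = N"
  using hpoly_carrier[OF assms, of t cs] by auto

lemma hpoly_commute:
  assumes "A \<in> carrier_mat N N"
  shows "hpoly t A cs \<odot>\<^bsub>t\<^esub> A = A \<odot>\<^bsub>t\<^esub> hpoly t A cs"
proof (induction cs)
  case (Cons c cs)
  have "hpoly t A (c # cs) \<odot>\<^bsub>t\<^esub> A = hmat_scaleR c A + A \<odot>\<^bsub>t\<^esub> (hpoly t A cs \<odot>\<^bsub>t\<^esub> A)"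
    using assms by (simp add: hmat_mult_simps)
  also have "\<dots> = A \<odot>\<^bsub>t\<^esub> hpoly t A (c # cs)"
    using assms Cons by (simp add: hmat_mult_simps)
  finally show ?case .
qed (use assms in simp)

lemma hpoly_snoc:
  assumes "A \<in> carrier_mat N N"
  shows "hpoly t A (cs @ [c]) = hpoly t A cs + hmat_scaleR c (hmat_pow t A (length cs))"
proof (induction cs)
  case Nil
  then show ?case using assms by (intro eq_matI) auto
next
  case (Cons d cs)
  have "hpoly t A ((d # cs) @ [c]) = hmat_scaleR d (hmat_one N) +
      (A \<odot>\<^bsub>t\<^esub> hpoly t A cs + hmat_scaleR c (A \<odot>\<^bsub>t\<^esub> hmat_pow t A (length cs)))"
    using assms Cons by (simp add: hmat_mult_simps)
  also have "\<dots> = (hmat_scaleR d (hmat_one N) + A \<odot>\<^bsub>t\<^esub> hpoly t A cs) +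
      hmat_scaleR c (hmat_pow t A (Suc (length cs)))"
    using assms
    by (subst assoc_add_mat[of _ N N]) (simp_all add: hmat_pow_Suc_left[OF assms] del: hmat_pow.simps)
  finally show ?case using assms by simp
qed

lemma hpoly_entry:
  assumes "A \<in> carrier_mat N N" "i < N" "j < N"
  shows "hpoly t A (map v [0..<d]) $$ (i, j) = (\<Sum>k<d. v k *\<^sub>R hmat_pow t A k $$ (i, j))"
  using assms(2,3)
  by (induction d) (use assms(1) in \<open>simp_all add: hpoly_snoc[OF assms(1)] add.commute\<close>)

text \<open>More vectors than coordinates: written as the columns of a square matrix whose additional last
  row is zero, they have determinant \<open>0\<close>.\<close>

lemma exists_linear_dependency:
  fixes f :: "nat \<Rightarrow> 'i \<Rightarrow> real"
  assumes "finite I"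
  obtains v k where "k \<le> card I" "v k \<noteq> 0" "\<forall>i\<in>I. (\<Sum>k\<le>card I. v k * f k i) = 0"
proof -
  define d where "d = card I"
  obtain e where e: "bij_betw e {0..<d} I"
    using ex_bij_betw_nat_finite[OF assms] by (auto simp: d_def)
  define M where "M = mat (Suc d) (Suc d) (\<lambda>(r, k). if r < d then f k (e r) else 0)"
  have M: "M \<in> carrier_mat (Suc d) (Suc d)" by (simp add: M_def)
  have "transpose_mat M *\<^sub>v unit_vec (Suc d) d = 0\<^sub>v (Suc d)"
    by (intro eq_vecI) (simp_all add: M_def scalar_prod_right_unit)
  moreover have "unit_vec (Suc d) d \<noteq> (0\<^sub>v (Suc d) :: real vec)" by simp
  ultimately have "\<exists>u. u \<in> carrier_vec (Suc d) \<and> u \<noteq> 0\<^sub>v (Suc d) \<and>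
      transpose_mat M *\<^sub>v u = 0\<^sub>v (Suc d)"
    by (intro exI[of _ "unit_vec (Suc d) d"] conjI unit_vec_carrier)
  then have "det (transpose_mat M) = 0"
    by (rule det_0_iff_vec_prod_zero_field[THEN iffD2, rotated]) (use M in simp)
  then have "det M = 0" using det_transpose[OF M] by simp
  then obtain v where v: "v \<in> carrier_vec (Suc d)" "v \<noteq> 0\<^sub>v (Suc d)" "M *\<^sub>v v = 0\<^sub>v (Suc d)"
    using det_0_iff_vec_prod_zero_field[OF M] by blast
  from v(1,2) obtain k where k: "k < Suc d" "v $ k \<noteq> 0"
    by (metis carrier_vecD eq_vecI index_zero_vec)
  have "(\<Sum>k\<le>d. v $ k * f k i) = 0" if "i \<in> I" for i
  proof -
    have "i \<in> e ` {0..<d}" using e that by (simp add: bij_betw_def)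
    then obtain r where r: "r < d" "i = e r" by auto
    have "(M *\<^sub>v v) $ r = (\<Sum>k\<in>{0..<Suc d}. M $$ (r, k) * v $ k)"
      using r M v(1) by (simp add: scalar_prod_def)
    also have "\<dots> = (\<Sum>k\<in>{0..<Suc d}. v $ k * f k i)"
      using r by (intro sum.cong) (simp_all add: M_def)
    also have "{0..<Suc d} = {..d}" by auto
    finally have "(\<Sum>k\<le>d. v $ k * f k i) = (M *\<^sub>v v) $ r" by (rule sym)
    then show ?thesis using v(3) r(1) by simp
  qed
  then show ?thesis using that[of k "\<lambda>k. v $ k"] k by (auto simp: d_def)
qed

text \<open>The matrices of size \<open>N\<close> form a real vector space of dimension \<open>4 N\<^sup>2\<close>, in which the powers
  of \<open>A\<close> cannot all be independent.\<close>

lemma annihilating_polynomial: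
  assumes A: "A \<in> carrier_mat N N"
  obtains cs c where "c \<noteq> 0" "hpoly t A (cs @ [c]) = 0\<^sub>m N N"
proof -
  \<comment> \<open>The four real coordinates of an element of the algebra.\<close>
  define comp :: "bool \<times> bool \<Rightarrow> hq \<Rightarrow> real" where
    "comp = (\<lambda>(a, b) q. (if b then Re else Im) ((if a then fst else snd) q))"
  have comp0: "q = 0" if "\<And>r. comp r q = 0" for q
    using that[of "(True, True)"] that[of "(True, False)"] that[of "(False, True)"]
      that[of "(False, False)"]
    by (simp add: comp_def prod_eq_iff complex_eq_iff)
  have comp_sum: "comp r (\<Sum>k\<le>d. v k *\<^sub>R g k) = (\<Sum>k\<le>d. v k * comp r (g k))" for r d v g
    by (auto simp: comp_def fst_sum snd_sum split: prod.splits)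
  define I :: "((bool \<times> bool) \<times> nat \<times> nat) set" where "I = UNIV \<times> {..<N} \<times> {..<N}"
  have "finite I" by (simp add: I_def)
  from exists_linear_dependency[OF this, of "\<lambda>k p. comp (fst p) (hmat_pow t A k $$ snd p)"]
  obtain v k where vk: "k \<le> card I" "v k \<noteq> 0"
    "\<forall>p\<in>I. (\<Sum>k\<le>card I. v k * comp (fst p) (hmat_pow t A k $$ snd p)) = 0"
    by blast
  define ds where "ds = map v [0..<Suc (card I)]"
  have "hpoly t A ds = 0\<^sub>m N N"
  proof (rule eq_matI)
    fix i j assume "i < dim_row (0\<^sub>m N N :: hmat)" "j < dim_col (0\<^sub>m N N :: hmat)"
    then have ij: "i < N" "j < N" by simp_all
    then have "(\<Sum>k\<le>card I. v k *\<^sub>R hmat_pow t A k $$ (i, j)) = 0"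
      using bspec[OF vk(3), of "(r, i, j)" for r] by (intro comp0) (simp add: comp_sum I_def)
    then show "hpoly t A ds $$ (i, j) = 0\<^sub>m N N $$ (i, j)"
      unfolding ds_def hpoly_entry[OF A ij] using ij by (simp add: lessThan_Suc_atMost)
  qed (use A in simp_all)
  moreover have "\<exists>x\<in>set ds. x \<noteq> 0"
    using vk(1,2) unfolding ds_def set_map set_upt by (intro bexI[of _ "v k"] imageI) simp_all
  \<comment> \<open>Trailing zero coefficients are dropped until the last one is nonzero.\<close>
  ultimately have "\<exists>cs c. c \<noteq> 0 \<and> hpoly t A (cs @ [c]) = 0\<^sub>m N N"
  proof (induction ds rule: rev_induct)
    case (snoc x xs)
    show ?case
    proof (cases "x = 0")
      case True
      have "hpoly t A (xs @ [x]) = hpoly t A xs"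
        unfolding hpoly_snoc[OF A] using A True by (intro eq_matI) auto
      then show ?thesis using snoc True by auto
    qed (use snoc in blast)
  qed simp
  then show ?thesis using that by blast
qed

text \<open>An annihilating polynomial without constant term is \<open>A\<close> times a polynomial in \<open>A\<close>, and the
  factor \<open>A\<close> can be cancelled. After finitely many cancellations the constant term is some
  \<open>c \<noteq> 0\<close>, and \<open>A p(A) = - c I\<close> exhibits the inverse. Since cancellation is demanded only for
  polynomials in \<open>A\<close>, which commute with \<open>A\<close>, a left or a right kernel argument suffices to
  apply the criterion.\<close>

lemma inverse_if_no_nilpotent_part:
  assumes A: "A \<in> carrier_mat N N"
    and cancel: "\<And>cs. A \<odot>\<^bsub>t\<^esub> hpoly t A cs = 0\<^sub>m N N \<Longrightarrow> hpoly t A cs = 0\<^sub>m N N"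
  obtains r cs where "hmat_is_inverse t A (hmat_scaleR r (hpoly t A cs))"
proof -
  obtain ds d where ds: "d \<noteq> 0" "hpoly t A (ds @ [d]) = 0\<^sub>m N N"
    using annihilating_polynomial[OF A] by metis
  have "\<exists>c cs. c \<noteq> 0 \<and> hpoly t A (c # cs) = 0\<^sub>m N N"
    if "hpoly t A es = 0\<^sub>m N N" "\<exists>x\<in>set es. x \<noteq> 0" for es
    using that
  proof (induction es)
    case (Cons x xs)
    show ?case
    proof (cases "x = 0")
      case True
      then have "hpoly t A (x # xs) = A \<odot>\<^bsub>t\<^esub> hpoly t A xs"
        using A by (intro eq_matI) auto
      then show ?thesis using Cons True cancel by auto
    qed (use Cons in blast)
  qed simp
  from this[OF ds(2)] ds(1)
  obtain c cs where c: "c \<noteq> 0" and z: "hpoly t A (c # cs) = 0\<^sub>m N N" by auto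
  have inv: "A \<odot>\<^bsub>t\<^esub> hmat_scaleR (- inverse c) (hpoly t A cs) = hmat_one N"
  proof (rule eq_matI)
    fix i j assume "i < dim_row (hmat_one N)" "j < dim_col (hmat_one N)"
    then have ij: "i < N" "j < N" by simp_all
    have "hpoly t A (c # cs) $$ (i, j) = 0" using ij z by simp
    then have "c *\<^sub>R hmat_one N $$ (i, j) + (A \<odot>\<^bsub>t\<^esub> hpoly t A cs) $$ (i, j) = 0"
      using A ij by (simp del: hmat_index(1,3))
    then have "(A \<odot>\<^bsub>t\<^esub> hpoly t A cs) $$ (i, j) = - c *\<^sub>R hmat_one N $$ (i, j)"
      by (metis add_eq_0_iff scaleR_minus_left)
    then show "(A \<odot>\<^bsub>t\<^esub> hmat_scaleR (- inverse c) (hpoly t A cs)) $$ (i, j) = hmat_one N $$ (i, j)"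
      using A ij c by (simp add: hmat_mult_scaleR_right del: hmat_index(1,3))
  qed (use A in simp_all)
  moreover have "hmat_scaleR (- inverse c) (hpoly t A cs) \<odot>\<^bsub>t\<^esub> A = hmat_one N"
    using inv A by (simp add: hmat_mult_scaleR_left hmat_mult_scaleR_right hpoly_commute)
  ultimately show ?thesis
    using A by (intro that[of "- inverse c" cs] hmat_is_inverseI[of _ N]) simp_all
qed

section \<open>The resolvent near the origin\<close>

text \<open>The sum of the norms of the entries, submultiplicative up to the factor \<open>3 + \<bar>t\<bar>\<close>.\<close>

definition hnorm :: "hmat \<Rightarrow> real" where
  "hnorm M = (\<Sum>i<dim_row M. \<Sum>j<dim_col M. norm (M $$ (i, j)))"

lemma hnorm_nonneg [simp]: "0 \<le> hnorm M"
  by (simp add: hnorm_def sum_nonneg)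

lemma hnorm_zero [simp]: "hnorm (0\<^sub>m a b) = 0"
  by (simp add: hnorm_def)

lemma hnorm_entry_le:
  assumes "i < dim_row M" "j < dim_col M"
  shows "norm (M $$ (i, j)) \<le> hnorm M"
proof -
  have "norm (M $$ (i, j)) \<le> (\<Sum>j<dim_col M. norm (M $$ (i, j)))"
    using assms by (intro member_le_sum) simp_all
  also have "\<dots> \<le> hnorm M"
    unfolding hnorm_def
    using assms by (intro member_le_sum[of i _ "\<lambda>i. \<Sum>j<dim_col M. norm (M $$ (i, j))"])
      (simp_all add: sum_nonneg)
  finally show ?thesis .
qed

lemma hnorm_eq_0: "hnorm M \<le> 0 \<Longrightarrow> M = 0\<^sub>m (dim_row M) (dim_col M)"
proof (rule eq_matI)
  fix i j assume "hnorm M \<le> 0" "i < dim_row (0\<^sub>m (dim_row M) (dim_col M) :: hmat)"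
    "j < dim_col (0\<^sub>m (dim_row M) (dim_col M) :: hmat)"
  then show "M $$ (i, j) = 0\<^sub>m (dim_row M) (dim_col M) $$ (i, j)"
    using order_trans[OF hnorm_entry_le[of i M j], of 0] by simp
qed simp_all

lemma hnorm_scaleR [simp]: "hnorm (hmat_scaleR x M) = \<bar>x\<bar> * hnorm M"
  by (simp add: hnorm_def sum_distrib_left)

lemma hnorm_triangle:
  "dim_row P = dim_row Q \<Longrightarrow> dim_col P = dim_col Q \<Longrightarrow> hnorm (P + Q) \<le> hnorm P + hnorm Q"
  unfolding hnorm_def by (simp add: sum.distrib[symmetric] sum_mono norm_triangle_ineq)

lemma hnorm_triangle4:
  "dim_row P = dim_row Q \<Longrightarrow> dim_col P = dim_col Q \<Longrightarrow> hnorm (P - Q) \<le> hnorm P + hnorm Q"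
  unfolding hnorm_def by (simp add: sum.distrib[symmetric] sum_mono norm_triangle_ineq4)

lemma hnorm_adj [simp]: "hnorm (M\<^sup>\<circledast>) = hnorm M"
proof -
  have "norm (hq_adj q) = norm q" for q
    by (cases q) (simp add: hq_adj_def norm_Pair)
  then show ?thesis
    unfolding hnorm_def by (simp add: sum.swap[of _ "{..<dim_row M}"])
qed

lemma norm_hq_mult_le: "norm (hq_mult t p q) \<le> (3 + \<bar>t\<bar>) * (norm p * norm q)"
proof -
  have le: "norm (fst r) \<le> norm r" "norm (snd r) \<le> norm r" for r :: hq
    using norm_fst_le[of "fst r" "snd r"] norm_snd_le[of "snd r" "fst r"] by simp_all
  have prods: "norm (fst p) * norm (fst q) \<le> norm p * norm q"
    "norm (snd p) * norm (snd q) \<le> norm p * norm q"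
    "norm (fst p) * norm (snd q) \<le> norm p * norm q"
    "norm (snd p) * norm (fst q) \<le> norm p * norm q"
    by (intro mult_mono le norm_ge_zero)+
  have "norm (hq_mult t p q) \<le> norm (fst (hq_mult t p q)) + norm (snd (hq_mult t p q))"
    by (metis norm_Pair_le prod.collapse)
  also have "norm (fst (hq_mult t p q)) \<le>
      norm (fst p) * norm (fst q) + \<bar>t\<bar> * (norm (snd p) * norm (snd q))"
    unfolding hq_mult_def fst_conv
    by (rule order_trans[OF norm_triangle_ineq]) (simp add: norm_mult)
  also have "norm (snd (hq_mult t p q)) \<le>
      norm (fst p) * norm (snd q) + norm (snd p) * norm (fst q)"
    unfolding hq_mult_def snd_conv
    by (rule order_trans[OF norm_triangle_ineq]) (simp add: norm_mult)
  also have "norm (fst p) * norm (fst q) + \<bar>t\<bar> * (norm (snd p) * norm (snd q)) +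
      (norm (fst p) * norm (snd q) + norm (snd p) * norm (fst q)) \<le>
      norm p * norm q + \<bar>t\<bar> * (norm p * norm q) + (norm p * norm q + norm p * norm q)"
    by (intro add_mono mult_left_mono prods) simp_all
  finally show ?thesis by (simp add: algebra_simps)
qed

lemma hnorm_mult:
  assumes "dim_col P = dim_row Q"
  shows "hnorm (P \<odot>\<^bsub>t\<^esub> Q) \<le> (3 + \<bar>t\<bar>) * (hnorm P * hnorm Q)"
proof -
  have "hnorm (P \<odot>\<^bsub>t\<^esub> Q) \<le> (\<Sum>i<dim_row P. \<Sum>j<dim_col Q. \<Sum>k<dim_col P.
      (3 + \<bar>t\<bar>) * (norm (P $$ (i, k)) * norm (Q $$ (k, j))))"
    unfolding hnorm_def
    by (auto intro!: sum_mono order_trans[OF norm_sum] norm_hq_mult_le)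
  also have "\<dots> = (3 + \<bar>t\<bar>) * (\<Sum>i<dim_row P. \<Sum>j<dim_col Q. \<Sum>k<dim_col P.
      norm (P $$ (i, k)) * norm (Q $$ (k, j)))"
    by (simp only: sum_distrib_left)
  also have "(\<Sum>i<dim_row P. \<Sum>j<dim_col Q. \<Sum>k<dim_col P.
      norm (P $$ (i, k)) * norm (Q $$ (k, j))) =
      (\<Sum>i<dim_row P. \<Sum>k<dim_col P. norm (P $$ (i, k)) * (\<Sum>j<dim_col Q. norm (Q $$ (k, j))))"
    by (simp only: sum_distrib_left sum.swap[of _ "{..<dim_col Q}"])
  also have "\<dots> \<le> (\<Sum>i<dim_row P. \<Sum>k<dim_col P. norm (P $$ (i, k)) * hnorm Q)"
  proof (intro sum_mono mult_left_mono norm_ge_zero)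
    fix k assume "k \<in> {..<dim_col P}"
    then show "(\<Sum>j<dim_col Q. norm (Q $$ (k, j))) \<le> hnorm Q"
      unfolding hnorm_def using assms
      by (intro member_le_sum[of k _ "\<lambda>k. \<Sum>j<dim_col Q. norm (Q $$ (k, j))"])
        (simp_all add: sum_nonneg)
  qed
  also have "\<dots> = hnorm P * hnorm Q"
    by (simp add: hnorm_def sum_distrib_right)
  finally show ?thesis by (simp add: mult_left_mono)
qed

text \<open>Stands in for the limit \<open>x \<rightarrow> 0\<close> from the right, without a topology on matrices.\<close>

lemma hmat_eq_0_if_small:
  assumes "\<epsilon> > 0" and small: "\<And>x. 0 < x \<Longrightarrow> x < \<epsilon> \<Longrightarrow> hnorm V \<le> x * K"
  shows "V = 0\<^sub>m (dim_row V) (dim_col V)"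
proof (rule hnorm_eq_0, rule ccontr)
  assume "\<not> hnorm V \<le> 0"
  then have V: "hnorm V > 0" by simp
  have "0 < \<epsilon> / 2 * K" using small[of "\<epsilon> / 2"] V assms(1) by linarith
  then have K: "K > 0" using assms(1) by (simp add: zero_less_mult_iff)
  define x where "x = min (\<epsilon> / 2) (hnorm V / (2 * K))"
  have "hnorm V \<le> x * K" using V K assms(1) by (intro small) (auto simp: x_def)
  also have "\<dots> \<le> hnorm V / (2 * K) * K" using K by (intro mult_right_mono) (auto simp: x_def)
  also have "\<dots> < hnorm V" using V K by simp
  finally show False by simp
qed

lemma hpencil_carrier: "A \<in> carrier_mat N N \<Longrightarrow> hpencil A x \<in> carrier_mat N N"
  by simp

text \<open>If \<open>x\<close> is small, then \<open>M = x A M\<close> implies \<open>\<parallel>M\<parallel> \<le> \<parallel>M\<parallel> / 2\<close>, so \<open>I - x A\<close> can be cancelled and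
  is invertible. The same estimate for \<open>X = I + x A X\<close> bounds the inverse by \<open>2 \<parallel>I\<parallel>\<close>. That the
  inverse is a polynomial in \<open>I - x A\<close> is what makes invariant subspaces of \<open>A\<close> invariant under
  the resolvent.\<close>

lemma resolvent_near_origin:
  assumes A: "A \<in> carrier_mat N N"
  obtains \<epsilon> K where "\<epsilon> > 0" "\<And>x. \<bar>x\<bar> < \<epsilon> \<Longrightarrow>
      \<exists>r cs. hmat_is_inverse t (hpencil A x) (hmat_scaleR r (hpoly t (hpencil A x) cs))"
    "\<And>x X. \<bar>x\<bar> < \<epsilon> \<Longrightarrow> hmat_is_inverse t (hpencil A x) X \<Longrightarrow> hnorm X \<le> K"
proof -
  define k where "k = (3 + \<bar>t\<bar>) * hnorm A"
  have k: "k \<ge> 0" by (simp add: k_def)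
  \<comment> \<open>Chosen such that multiplication by \<open>x A\<close> at least halves the norm; the summand \<open>1\<close> covers \<open>k = 0\<close>.\<close>
  define \<epsilon> where "\<epsilon> = 1 / (2 * (k + 1))"
  have \<epsilon>: "\<epsilon> > 0" using k by (simp add: \<epsilon>_def)
  have half: "hnorm (hmat_scaleR x (A \<odot>\<^bsub>t\<^esub> M)) \<le> hnorm M / 2"
    if x: "\<bar>x\<bar> < \<epsilon>" and M: "dim_row M = N" for x M
  proof -
    have "\<bar>x\<bar> * k \<le> \<epsilon> * k" using x k by (intro mult_right_mono) simp_all
    also have "\<dots> \<le> 1 / 2" using k by (simp add: \<epsilon>_def field_simps)
    finally have "\<bar>x\<bar> * k \<le> 1 / 2" .
    moreover have "hnorm (hmat_scaleR x (A \<odot>\<^bsub>t\<^esub> M)) \<le> \<bar>x\<bar> * ((3 + \<bar>t\<bar>) * (hnorm A * hnorm M))"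
      using A M by (simp only: hnorm_scaleR) (intro mult_left_mono hnorm_mult, simp_all)
    moreover have "\<bar>x\<bar> * ((3 + \<bar>t\<bar>) * (hnorm A * hnorm M)) = (\<bar>x\<bar> * k) * hnorm M"
      by (simp add: k_def)
    ultimately show ?thesis
      using mult_right_mono[of "\<bar>x\<bar> * k" "1 / 2" "hnorm M"] by simp
  qed
  show ?thesis
  proof (rule that[of \<epsilon> "2 * hnorm (hmat_one N)"])
    fix x assume x: "\<bar>x\<bar> < \<epsilon>"
    have P: "hpencil A x \<in> carrier_mat N N" using A by (rule hpencil_carrier)
    have mult: "hpencil A x \<odot>\<^bsub>t\<^esub> M = M - hmat_scaleR x (A \<odot>\<^bsub>t\<^esub> M)" if "dim_row M = N" for M
      using A that by (simp add: hmat_mult_simps)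
    have "hpoly t (hpencil A x) cs = 0\<^sub>m N N"
      if z: "hpencil A x \<odot>\<^bsub>t\<^esub> hpoly t (hpencil A x) cs = 0\<^sub>m N N" for cs
    proof -
      define M where "M = hpoly t (hpencil A x) cs"
      have M: "M \<in> carrier_mat N N" unfolding M_def using P by (rule hpoly_carrier)
      have "M = hmat_scaleR x (A \<odot>\<^bsub>t\<^esub> M)"
      proof (rule eq_matI)
        fix i j assume "i < dim_row (hmat_scaleR x (A \<odot>\<^bsub>t\<^esub> M))"
          "j < dim_col (hmat_scaleR x (A \<odot>\<^bsub>t\<^esub> M))"
        then have ij: "i < N" "j < N" using A M by simp_all
        have "M - hmat_scaleR x (A \<odot>\<^bsub>t\<^esub> M) = 0\<^sub>m N N"
          using mult[of M] M z unfolding M_def[symmetric] by simp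
        then have "(M - hmat_scaleR x (A \<odot>\<^bsub>t\<^esub> M)) $$ (i, j) = 0"
          using ij by simp
        then show "M $$ (i, j) = hmat_scaleR x (A \<odot>\<^bsub>t\<^esub> M) $$ (i, j)"
          using A M ij by (simp del: hmat_index)
      qed (use A M in simp_all)
      then have "hnorm M \<le> hnorm M / 2" using half[OF x, of M] M by simp
      then have "hnorm M \<le> 0" by simp
      then show ?thesis using hnorm_eq_0[of M] M by (simp add: M_def)
    qed
    then show "\<exists>r cs. hmat_is_inverse t (hpencil A x) (hmat_scaleR r (hpoly t (hpencil A x) cs))"
      using inverse_if_no_nilpotent_part[OF P, of t] by metis
    fix X assume "hmat_is_inverse t (hpencil A x) X"
    then have X: "X \<in> carrier_mat N N" "hpencil A x \<odot>\<^bsub>t\<^esub> X = hmat_one N"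
      using hmat_is_inverseD[OF _ P] by auto
    have "X = hmat_one N + hmat_scaleR x (A \<odot>\<^bsub>t\<^esub> X)"
      unfolding X(2)[symmetric] using mult[of X] X(1) A by (intro eq_matI) simp_all
    then have "hnorm X \<le> hnorm (hmat_one N) + hnorm (hmat_scaleR x (A \<odot>\<^bsub>t\<^esub> X))"
      using hnorm_triangle[of "hmat_one N" "hmat_scaleR x (A \<odot>\<^bsub>t\<^esub> X)"] X(1) A by simp
    then show "hnorm X \<le> 2 * hnorm (hmat_one N)" using half[OF x, of X] X(1) by simp
  qed (rule \<epsilon>)
qed

section \<open>Observability, controllability and the state matrix\<close>

text \<open>The definition tests single rows; a matrix \<open>M\<close> is tested row by row.\<close>

lemma controllable_left_cancel:
  assumes ctrl: "controllable t n N A B"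
    and A: "A \<in> carrier_mat N N" and B: "B \<in> carrier_mat N n" and M: "M \<in> carrier_mat m N"
    and z: "\<And>k. M \<odot>\<^bsub>t\<^esub> (hmat_pow t A k \<odot>\<^bsub>t\<^esub> B) = 0\<^sub>m m n"
  shows "M = 0\<^sub>m m N"
proof (rule eq_matI)
  fix i j assume "i < dim_row (0\<^sub>m m N :: hmat)" "j < dim_col (0\<^sub>m m N :: hmat)"
  then have ij: "i < m" "j < N" by simp_all
  define h where "h = mat 1 N (\<lambda>(_, j). M $$ (i, j))"
  have h: "h \<in> carrier_mat 1 N" by (simp add: h_def)
  have "h \<odot>\<^bsub>t\<^esub> hmat_pow t A k \<odot>\<^bsub>t\<^esub> B = 0\<^sub>m 1 n" for k
  proof (rule eq_matI)
    fix r s assume "r < dim_row (0\<^sub>m 1 n :: hmat)" "s < dim_col (0\<^sub>m 1 n :: hmat)"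
    then have rs: "r = 0" "s < n" by simp_all
    have "(h \<odot>\<^bsub>t\<^esub> (hmat_pow t A k \<odot>\<^bsub>t\<^esub> B)) $$ (0, s) = (M \<odot>\<^bsub>t\<^esub> (hmat_pow t A k \<odot>\<^bsub>t\<^esub> B)) $$ (i, s)"
      using A B M rs ij by (simp add: h_def)
    then show "(h \<odot>\<^bsub>t\<^esub> hmat_pow t A k \<odot>\<^bsub>t\<^esub> B) $$ (r, s) = 0\<^sub>m 1 n $$ (r, s)"
      using A B h rs ij z[of k] by (simp add: hmat_mult_assoc del: hmat_index)
  qed (use A B h in simp_all)
  then have "h = 0\<^sub>m 1 N" using ctrl h unfolding controllable_def by blast
  then have "h $$ (0, j) = 0" using ij by simp
  then show "M $$ (i, j) = 0\<^sub>m m N $$ (i, j)" using ij by (simp add: h_def)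
qed (use M in simp_all)

text \<open>The definition uses the resolvent, the moments use powers. The columns \<open>v\<close> with \<open>C A\<^sup>k v = 0\<close>
  for all \<open>k\<close> form a space that is invariant under \<open>A\<close>, hence under \<open>(I - x A)\<^sup>-\<^sup>1\<close>, which near
  the origin is a polynomial in \<open>I - x A\<close>. So \<open>C (I - x A)\<^sup>-\<^sup>1\<close> annihilates such columns.\<close>

lemma observable_right_cancel:
  assumes obs: "observable t n N C A"
    and A: "A \<in> carrier_mat N N" and C: "C \<in> carrier_mat n N" and M: "M \<in> carrier_mat N m"
    and z: "\<And>k. C \<odot>\<^bsub>t\<^esub> (hmat_pow t A k \<odot>\<^bsub>t\<^esub> M) = 0\<^sub>m n m"
  shows "M = 0\<^sub>m N m"
proof (rule eq_matI)
  fix i j assume "i < dim_row (0\<^sub>m N m :: hmat)" "j < dim_col (0\<^sub>m N m :: hmat)"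
  then have ij: "i < N" "j < m" by simp_all
  define h where "h = mat N 1 (\<lambda>(i, _). M $$ (i, j))"
  have h: "h \<in> carrier_mat N 1" by (simp add: h_def)
  define null where "null v \<longleftrightarrow> v \<in> carrier_mat N 1 \<and>
    (\<forall>k. C \<odot>\<^bsub>t\<^esub> (hmat_pow t A k \<odot>\<^bsub>t\<^esub> v) = 0\<^sub>m n 1)" for v
  have null_h: "null h"
    unfolding null_def
  proof (intro conjI allI h eq_matI)
    fix k r s assume "r < dim_row (0\<^sub>m n 1 :: hmat)" "s < dim_col (0\<^sub>m n 1 :: hmat)"
    then have rs: "r < n" "s = 0" by simp_all
    have "((C \<odot>\<^bsub>t\<^esub> hmat_pow t A k) \<odot>\<^bsub>t\<^esub> h) $$ (r, 0) = ((C \<odot>\<^bsub>t\<^esub> hmat_pow t A k) \<odot>\<^bsub>t\<^esub> M) $$ (r, j)"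
      using A C M rs ij by (simp add: h_def)
    then show "(C \<odot>\<^bsub>t\<^esub> (hmat_pow t A k \<odot>\<^bsub>t\<^esub> h)) $$ (r, s) = 0\<^sub>m n 1 $$ (r, s)"
      using A C h M rs ij z[of k] by (simp add: hmat_mult_assoc del: hmat_index)
  qed (use A C h in simp_all)
  have null_add: "null (hmat_scaleR c v + w)" if "null v" "null w" for c v w
    using that A C
    by (auto simp: null_def hmat_mult_add_right hmat_mult_scaleR_right)
  have null_pencil: "null (hpencil A x \<odot>\<^bsub>t\<^esub> v)" if v: "null v" for x v
  proof -
    from v have v': "v \<in> carrier_mat N 1"
      "\<And>k. C \<odot>\<^bsub>t\<^esub> (hmat_pow t A k \<odot>\<^bsub>t\<^esub> v) = 0\<^sub>m n 1"
      by (simp_all add: null_def)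
    have "hmat_pow t A k \<odot>\<^bsub>t\<^esub> (A \<odot>\<^bsub>t\<^esub> v) = hmat_pow t A (Suc k) \<odot>\<^bsub>t\<^esub> v" for k
      using A by (simp add: hmat_mult_assoc)
    then have "null (A \<odot>\<^bsub>t\<^esub> v)" using v' A by (simp add: null_def del: hmat_pow.simps)
    then have "null (hmat_scaleR (- x) (A \<odot>\<^bsub>t\<^esub> v) + v)" by (rule null_add) (rule v)
    also have "hmat_scaleR (- x) (A \<odot>\<^bsub>t\<^esub> v) + v = hpencil A x \<odot>\<^bsub>t\<^esub> v"
      using A v'(1) by (intro eq_matI) (simp_all add: hmat_mult_simps del: hmat_index(1))
    finally show ?thesis .
  qed
  have null_poly: "null (hpoly t (hpencil A x) cs \<odot>\<^bsub>t\<^esub> h)" for x cs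
  proof (induction cs)
    case Nil
    show ?case using A C h by (simp add: null_def)
  next
    case (Cons c cs)
    have P: "hpencil A x \<in> carrier_mat N N" using A by (rule hpencil_carrier)
    have "hpoly t (hpencil A x) (c # cs) \<odot>\<^bsub>t\<^esub> h =
        hmat_scaleR c h + hpencil A x \<odot>\<^bsub>t\<^esub> (hpoly t (hpencil A x) cs \<odot>\<^bsub>t\<^esub> h)"
      using P A h hpoly_dims[OF P, of t cs]
      by (simp add: hmat_mult_add_left hmat_mult_assoc hmat_mult_scaleR_left)
    then show ?case using null_add[OF null_h null_pencil[OF Cons]] by simp
  qed
  obtain \<epsilon> where \<epsilon>: "\<epsilon> > 0" and inv: "\<And>x. \<bar>x\<bar> < \<epsilon> \<Longrightarrow>
      \<exists>r cs. hmat_is_inverse t (hpencil A x) (hmat_scaleR r (hpoly t (hpencil A x) cs))"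
    using resolvent_near_origin[OF A, of t] by metis
  have "hmat_invertible t (hpencil A x) \<and> C \<odot>\<^bsub>t\<^esub> hmat_inv t (hpencil A x) \<odot>\<^bsub>t\<^esub> h = 0\<^sub>m n 1"
    if "x \<in> {-\<epsilon><..<\<epsilon>}" for x
  proof -
    from that have "\<bar>x\<bar> < \<epsilon>" by auto
    then obtain r cs where X:
      "hmat_is_inverse t (hpencil A x) (hmat_scaleR r (hpoly t (hpencil A x) cs))"
      using inv by blast
    have P: "hpencil A x \<in> carrier_mat N N" using A by (rule hpencil_carrier)
    have "C \<odot>\<^bsub>t\<^esub> (hmat_pow t A 0 \<odot>\<^bsub>t\<^esub> (hpoly t (hpencil A x) cs \<odot>\<^bsub>t\<^esub> h)) = 0\<^sub>m n 1"
      using null_poly unfolding null_def by blast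
    then have "C \<odot>\<^bsub>t\<^esub> (hpoly t (hpencil A x) cs \<odot>\<^bsub>t\<^esub> h) = 0\<^sub>m n 1"
      using hpoly_dims[OF P, of t cs] A by simp
    then have "C \<odot>\<^bsub>t\<^esub> hmat_inv t (hpencil A x) \<odot>\<^bsub>t\<^esub> h = 0\<^sub>m n 1"
      unfolding hmat_inv_eqI[OF X] using C h hpoly_dims[OF P, of t cs]
      by (simp add: hmat_mult_assoc hmat_mult_scaleR_left hmat_mult_scaleR_right)
    then show ?thesis using X unfolding hmat_invertible_def by blast
  qed
  then have "h = 0\<^sub>m N 1" using obs h \<epsilon> unfolding observable_def by blast
  then have "h $$ (i, 0) = 0" using ij by simp
  then show "M $$ (i, j) = 0\<^sub>m N m $$ (i, j)" using ij by (simp add: h_def)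
qed (use M in simp_all)

text \<open>A pole of \<open>(x I - A)\<^sup>-\<^sup>1\<close> at \<open>0\<close> cannot be hidden by \<open>B\<close> and \<open>C\<close> in a minimal realization.
  Let \<open>U = (x I - A)\<^sup>-\<^sup>1 B\<close>, so that \<open>A U = x U - B\<close>. By this equation boundedness of \<open>C U\<close> near
  \<open>0\<close> carries over to \<open>C p(A) U\<close> for every polynomial \<open>p\<close>. If \<open>M = p(A)\<close> satisfies \<open>A M = 0\<close>,
  then \<open>C M B = x C M U\<close>, which tends to \<open>0\<close>; hence \<open>C M B = 0\<close>, and all other products
  \<open>C A\<^sup>l M A\<^sup>k B\<close> vanish because they contain \<open>A M\<close>. Controllability and observability then give
  \<open>M = 0\<close>, which is the cancellation needed for the invertibility of \<open>A\<close>.\<close>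

lemma state_matrix_invertible:
  assumes A: "A \<in> carrier_mat N N" and B: "B \<in> carrier_mat N n" and C: "C \<in> carrier_mat n N"
    and obs: "observable t n N C A" and ctrl: "controllable t n N A B"
    and "\<epsilon> > 0" and bd: "\<And>x. 0 < x \<Longrightarrow> x < \<epsilon> \<Longrightarrow> \<exists>X. hmat_is_inverse t (hpencil A (1 / x)) X \<and>
      hnorm (hmat_scaleR (1 / x) (C \<odot>\<^bsub>t\<^esub> (X \<odot>\<^bsub>t\<^esub> B))) \<le> K"
  obtains E where "hmat_is_inverse t A E"
proof -
  \<comment> \<open>With \<open>x \<le> 1\<close> the factor \<open>x\<close> in the recursion below does not increase the bounds.\<close>
  define \<delta> where "\<delta> = min \<epsilon> 1"
  have \<delta>: "\<delta> > 0" using \<open>\<epsilon> > 0\<close> by (simp add: \<delta>_def)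
  have "\<exists>U. U \<in> carrier_mat N n \<and> A \<odot>\<^bsub>t\<^esub> U = hmat_scaleR x U - B \<and> hnorm (C \<odot>\<^bsub>t\<^esub> U) \<le> K"
    if x: "0 < x" "x < \<delta>" for x
  proof -
    obtain X where X: "hmat_is_inverse t (hpencil A (1 / x)) X"
      and K: "hnorm (hmat_scaleR (1 / x) (C \<odot>\<^bsub>t\<^esub> (X \<odot>\<^bsub>t\<^esub> B))) \<le> K"
      using bd[of x] x by (auto simp: \<delta>_def)
    have X': "X \<in> carrier_mat N N" "hpencil A (1 / x) \<odot>\<^bsub>t\<^esub> X = hmat_one N"
      using hmat_is_inverseD[OF X hpencil_carrier[OF A]] by auto
    define U where "U = hmat_scaleR (1 / x) (X \<odot>\<^bsub>t\<^esub> B)"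
    have "(hpencil A (1 / x) \<odot>\<^bsub>t\<^esub> X) \<odot>\<^bsub>t\<^esub> B = hmat_scaleR x U - A \<odot>\<^bsub>t\<^esub> U"
      using A X'(1) B x by (simp add: U_def hmat_mult_simps)
    moreover have "(hpencil A (1 / x) \<odot>\<^bsub>t\<^esub> X) \<odot>\<^bsub>t\<^esub> B = B" using X' B by simp
    ultimately have B_eq: "hmat_scaleR x U - A \<odot>\<^bsub>t\<^esub> U = B" by simp
    have "A \<odot>\<^bsub>t\<^esub> U = hmat_scaleR x U - B"
      unfolding B_eq[symmetric] using A B X'
      by (intro eq_matI) (simp_all add: U_def del: hmat_index(1))
    moreover have "hnorm (C \<odot>\<^bsub>t\<^esub> U) \<le> K"
      using K C X' B by (simp add: U_def hmat_mult_scaleR_right)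
    moreover have "U \<in> carrier_mat N n" using X' B by (simp add: U_def)
    ultimately show ?thesis by blast
  qed
  then obtain U where U: "\<And>x. 0 < x \<Longrightarrow> x < \<delta> \<Longrightarrow> U x \<in> carrier_mat N n"
    and AU: "\<And>x. 0 < x \<Longrightarrow> x < \<delta> \<Longrightarrow> A \<odot>\<^bsub>t\<^esub> U x = hmat_scaleR x (U x) - B"
    and K: "\<And>x. 0 < x \<Longrightarrow> x < \<delta> \<Longrightarrow> hnorm (C \<odot>\<^bsub>t\<^esub> U x) \<le> K"
    by metis
  have bounded: "\<exists>L. \<forall>x. 0 < x \<and> x < \<delta> \<longrightarrow> hnorm (C \<odot>\<^bsub>t\<^esub> (hpoly t A cs \<odot>\<^bsub>t\<^esub> U x)) \<le> L" for cs
  proof (induction cs)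
    case Nil
    have "hnorm (C \<odot>\<^bsub>t\<^esub> (hpoly t A [] \<odot>\<^bsub>t\<^esub> U x)) \<le> 0" if "0 < x" "x < \<delta>" for x
      using A C U[OF that] by simp
    then show ?case by blast
  next
    case (Cons c cs)
    then obtain L where L: "\<And>x. 0 < x \<Longrightarrow> x < \<delta> \<Longrightarrow> hnorm (C \<odot>\<^bsub>t\<^esub> (hpoly t A cs \<odot>\<^bsub>t\<^esub> U x)) \<le> L"
      by blast
    have "hnorm (C \<odot>\<^bsub>t\<^esub> (hpoly t A (c # cs) \<odot>\<^bsub>t\<^esub> U x)) \<le>
        \<bar>c\<bar> * K + (L + hnorm (C \<odot>\<^bsub>t\<^esub> (hpoly t A cs \<odot>\<^bsub>t\<^esub> B)))" if x: "0 < x" "x < \<delta>" for x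
    proof -
      let ?U = "U x" and ?Q = "hpoly t A cs"
      have "hpoly t A (c # cs) \<odot>\<^bsub>t\<^esub> ?U = hmat_scaleR c ?U + (?Q \<odot>\<^bsub>t\<^esub> A) \<odot>\<^bsub>t\<^esub> ?U"
        using A U[OF x] by (simp add: hpoly_commute hmat_mult_add_left hmat_mult_scaleR_left)
      also have "(?Q \<odot>\<^bsub>t\<^esub> A) \<odot>\<^bsub>t\<^esub> ?U = hmat_scaleR x (?Q \<odot>\<^bsub>t\<^esub> ?U) - ?Q \<odot>\<^bsub>t\<^esub> B"
        using A U[OF x] B by (simp add: AU[OF x] hmat_mult_simps)
      finally have eq: "C \<odot>\<^bsub>t\<^esub> (hpoly t A (c # cs) \<odot>\<^bsub>t\<^esub> ?U) = hmat_scaleR c (C \<odot>\<^bsub>t\<^esub> ?U) +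
          (hmat_scaleR x (C \<odot>\<^bsub>t\<^esub> (?Q \<odot>\<^bsub>t\<^esub> ?U)) - C \<odot>\<^bsub>t\<^esub> (?Q \<odot>\<^bsub>t\<^esub> B))"
        using A B C U[OF x] by (simp add: hmat_mult_simps)
      have "x * hnorm (C \<odot>\<^bsub>t\<^esub> (?Q \<odot>\<^bsub>t\<^esub> ?U)) \<le> hnorm (C \<odot>\<^bsub>t\<^esub> (?Q \<odot>\<^bsub>t\<^esub> ?U))"
        using x by (intro mult_left_le_one_le) (simp_all add: \<delta>_def)
      then have "hnorm (hmat_scaleR x (C \<odot>\<^bsub>t\<^esub> (?Q \<odot>\<^bsub>t\<^esub> ?U))) \<le> L"
        using L[OF x] x by simp
      moreover have "hnorm (hmat_scaleR c (C \<odot>\<^bsub>t\<^esub> ?U)) \<le> \<bar>c\<bar> * K"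
        using K[OF x] by (simp add: mult_left_mono)
      moreover have "hnorm (hmat_scaleR c (C \<odot>\<^bsub>t\<^esub> ?U) +
          (hmat_scaleR x (C \<odot>\<^bsub>t\<^esub> (?Q \<odot>\<^bsub>t\<^esub> ?U)) - C \<odot>\<^bsub>t\<^esub> (?Q \<odot>\<^bsub>t\<^esub> B))) \<le>
          hnorm (hmat_scaleR c (C \<odot>\<^bsub>t\<^esub> ?U)) + (hnorm (hmat_scaleR x (C \<odot>\<^bsub>t\<^esub> (?Q \<odot>\<^bsub>t\<^esub> ?U))) +
          hnorm (C \<odot>\<^bsub>t\<^esub> (?Q \<odot>\<^bsub>t\<^esub> B)))"
        using A B C U[OF x]
        by (intro order_trans[OF hnorm_triangle] add_left_mono hnorm_triangle4) simp_all
      ultimately show ?thesis unfolding eq by linarith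
    qed
    then show ?case by blast
  qed
  have cancel: "hpoly t A cs = 0\<^sub>m N N" if z: "A \<odot>\<^bsub>t\<^esub> hpoly t A cs = 0\<^sub>m N N" for cs
  proof -
    define M where "M = hpoly t A cs"
    have M: "M \<in> carrier_mat N N" using A by (simp add: M_def)
    have AM: "A \<odot>\<^bsub>t\<^esub> M = 0\<^sub>m N N" and MA: "M \<odot>\<^bsub>t\<^esub> A = 0\<^sub>m N N"
      using z A by (simp_all add: M_def hpoly_commute)
    obtain L where L: "\<And>x. 0 < x \<Longrightarrow> x < \<delta> \<Longrightarrow> hnorm (C \<odot>\<^bsub>t\<^esub> (M \<odot>\<^bsub>t\<^esub> U x)) \<le> L"
      using bounded[of cs] unfolding M_def by blast
    have "hnorm (C \<odot>\<^bsub>t\<^esub> (M \<odot>\<^bsub>t\<^esub> B)) \<le> x * L" if x: "0 < x" "x < \<delta>" for x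
    proof -
      have "(M \<odot>\<^bsub>t\<^esub> A) \<odot>\<^bsub>t\<^esub> U x = hmat_scaleR x (M \<odot>\<^bsub>t\<^esub> U x) - M \<odot>\<^bsub>t\<^esub> B"
        using A B M U[OF x] by (simp add: AU[OF x] hmat_mult_simps)
      then have *: "hmat_scaleR x (M \<odot>\<^bsub>t\<^esub> U x) - M \<odot>\<^bsub>t\<^esub> B = 0\<^sub>m N n"
        using MA U[OF x] by simp
      have "M \<odot>\<^bsub>t\<^esub> B = hmat_scaleR x (M \<odot>\<^bsub>t\<^esub> U x) - (hmat_scaleR x (M \<odot>\<^bsub>t\<^esub> U x) - M \<odot>\<^bsub>t\<^esub> B)"
        using M B U[OF x] by (intro eq_matI) (simp_all del: hmat_index(1))
      also have "\<dots> = hmat_scaleR x (M \<odot>\<^bsub>t\<^esub> U x)"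
        unfolding * using M U[OF x] by (intro eq_matI) simp_all
      finally have "C \<odot>\<^bsub>t\<^esub> (M \<odot>\<^bsub>t\<^esub> B) = hmat_scaleR x (C \<odot>\<^bsub>t\<^esub> (M \<odot>\<^bsub>t\<^esub> U x))"
        using C M by (simp add: hmat_mult_scaleR_right)
      then show ?thesis using L[OF x] x by simp
    qed
    from hmat_eq_0_if_small[OF \<delta> this] have CMB: "C \<odot>\<^bsub>t\<^esub> (M \<odot>\<^bsub>t\<^esub> B) = 0\<^sub>m n n"
      using B C by simp
    have "(C \<odot>\<^bsub>t\<^esub> M) \<odot>\<^bsub>t\<^esub> (hmat_pow t A k \<odot>\<^bsub>t\<^esub> B) = 0\<^sub>m n n" for k
    proof (cases k)
      case 0
      then show ?thesis using A B C M CMB by (simp add: hmat_mult_assoc)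
    next
      case (Suc k')
      have "(C \<odot>\<^bsub>t\<^esub> M) \<odot>\<^bsub>t\<^esub> (hmat_pow t A k \<odot>\<^bsub>t\<^esub> B) =
          C \<odot>\<^bsub>t\<^esub> ((M \<odot>\<^bsub>t\<^esub> A) \<odot>\<^bsub>t\<^esub> (hmat_pow t A k' \<odot>\<^bsub>t\<^esub> B))"
        unfolding Suc hmat_pow_Suc_left[OF A] using A B C M by (simp add: hmat_mult_assoc)
      then show ?thesis using A B C by (simp add: MA)
    qed
    then have CM: "C \<odot>\<^bsub>t\<^esub> M = 0\<^sub>m n N"
      using controllable_left_cancel[OF ctrl A B, of "C \<odot>\<^bsub>t\<^esub> M" n] C M by simp
    have "C \<odot>\<^bsub>t\<^esub> (hmat_pow t A k \<odot>\<^bsub>t\<^esub> M) = 0\<^sub>m n N" for k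
    proof (cases k)
      case (Suc k')
      have "hmat_pow t A k \<odot>\<^bsub>t\<^esub> M = hmat_pow t A k' \<odot>\<^bsub>t\<^esub> (A \<odot>\<^bsub>t\<^esub> M)"
        using A M by (simp add: Suc hmat_mult_assoc)
      then show ?thesis using A C by (simp add: AM)
    qed (use A C M CM in simp)
    then show ?thesis using observable_right_cancel[OF obs A C M] by (simp add: M_def)
  qed
  from inverse_if_no_nilpotent_part[OF A this] that show ?thesis by metis
qed

text \<open>A power series that converges at \<open>y\<close> is dominated on \<open>(0, y / 2)\<close> by a geometric series of
  ratio \<open>1 / 2\<close>.\<close>

lemma regular_at_infinity_bounded:
  assumes reg: "regular_at_infinity n \<phi>"
    and dims: "\<forall>x Y. \<phi> x = Some Y \<longrightarrow> Y \<in> carrier_mat n n"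
  obtains \<epsilon> K where "\<epsilon> > 0" "\<And>x. 0 < x \<Longrightarrow> x < \<epsilon> \<Longrightarrow> \<exists>Y. \<phi> (1 / x) = Some Y \<and> hnorm Y \<le> K"
proof -
  obtain \<epsilon> c where "\<epsilon> > 0" and series: "\<And>x. 0 < \<bar>x\<bar> \<Longrightarrow> \<bar>x\<bar> < \<epsilon> \<Longrightarrow>
      \<exists>Y. \<phi> (1 / x) = Some Y \<and>
        (\<forall>i<n. \<forall>j<n. (\<lambda>k. (x ^ k) *\<^sub>R (c k i j :: hq)) sums (Y $$ (i, j)))"
    using reg unfolding regular_at_infinity_def by blast
  define y where "y = \<epsilon> / 2"
  have y: "0 < y" "y < \<epsilon>" using \<open>\<epsilon> > 0\<close> by (simp_all add: y_def)
  from series[of y] y obtain Y where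
    "\<forall>i<n. \<forall>j<n. (\<lambda>k. (y ^ k) *\<^sub>R c k i j) sums (Y $$ (i, j))"
    by auto
  then have "\<exists>L. \<forall>k. norm ((y ^ k) *\<^sub>R c k i j) \<le> L" if "i < n" "j < n" for i j
  proof -
    assume "\<forall>i<n. \<forall>j<n. (\<lambda>k. (y ^ k) *\<^sub>R c k i j) sums (Y $$ (i, j))"
    with that have "(\<lambda>k. (y ^ k) *\<^sub>R c k i j) sums (Y $$ (i, j))" by simp
    then have "summable (\<lambda>k. (y ^ k) *\<^sub>R c k i j)" by (rule sums_summable)
    then have "Bseq (\<lambda>k. (y ^ k) *\<^sub>R c k i j)"
      by (rule convergent_imp_Bseq[OF convergentI[OF summable_LIMSEQ_zero]])
    then show ?thesis by (meson BseqE)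
  qed
  then obtain L where L: "\<And>i j k. i < n \<Longrightarrow> j < n \<Longrightarrow> norm ((y ^ k) *\<^sub>R c k i j) \<le> L i j"
    by metis
  show ?thesis
  proof (rule that[of "y / 2" "\<Sum>i<n. \<Sum>j<n. 2 * L i j"])
    fix x :: real assume x: "0 < x" "x < y / 2"
    obtain Y where Y: "\<phi> (1 / x) = Some Y"
      and sums: "\<And>i j. i < n \<Longrightarrow> j < n \<Longrightarrow> (\<lambda>k. (x ^ k) *\<^sub>R c k i j) sums (Y $$ (i, j))"
      using series[of x] x y by auto
    have "norm (Y $$ (i, j)) \<le> 2 * L i j" if ij: "i < n" "j < n" for i j
    proof -
      have geo: "(\<lambda>k. L i j * (1 / 2) ^ k) sums (L i j * 2)"
        using sums_mult[OF geometric_sums[of "1 / 2 :: real"], of "L i j"] by simp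
      have "norm ((x ^ k) *\<^sub>R c k i j) \<le> L i j * (1 / 2) ^ k" for k
      proof -
        have "norm ((x ^ k) *\<^sub>R c k i j) = (x / y) ^ k * norm ((y ^ k) *\<^sub>R c k i j)"
          using x y by (simp add: power_divide)
        also have "\<dots> \<le> (1 / 2) ^ k * L i j"
          using x y ij by (intro mult_mono power_mono L) (simp_all add: field_simps)
        finally show ?thesis by (simp add: mult.commute)
      qed
      then have "norm (\<Sum>k. (x ^ k) *\<^sub>R c k i j) \<le> (\<Sum>k. L i j * (1 / 2) ^ k)"
        using sums_summable[OF geo] by (rule norm_suminf_le)
      then show ?thesis using geo sums[OF ij] by (simp add: sums_iff)
    qed
    moreover have "dim_row Y = n" "dim_col Y = n" using dims Y by auto
    ultimately have "hnorm Y \<le> (\<Sum>i<n. \<Sum>j<n. 2 * L i j)"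
      unfolding hnorm_def by (auto intro!: sum_mono)
    with Y show "\<exists>Y. \<phi> (1 / x) = Some Y \<and> hnorm Y \<le> (\<Sum>i<n. \<Sum>j<n. 2 * L i j)" by blast
  qed (use y in simp)
qed

section \<open>Intertwining two systems with equal moments\<close>

text \<open>The adjoint \<open>\<circledast>\<close> is not positive for \<open>t > 0\<close>: the real part of the product of \<open>a + b j\<^sub>t\<close> with its
  adjoint is \<open>\<bar>a\<bar>\<^sup>2 - t \<bar>b\<bar>\<^sup>2\<close>. This is the involution for which it becomes \<open>\<bar>a\<bar>\<^sup>2 + \<bar>t\<bar> \<bar>b\<bar>\<^sup>2\<close>. It is
  \<open>\<circledast>\<close> itself if \<open>t < 0\<close>, and \<open>\<circledast>\<close> followed by conjugation with the imaginary unit if \<open>t > 0\<close>.\<close>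

definition hq_pos_adj :: "real \<Rightarrow> hq \<Rightarrow> hq" where
  "hq_pos_adj t q = (cnj (fst q), of_real (sgn t) * snd q)"

definition hmat_pos_adj :: "real \<Rightarrow> hmat \<Rightarrow> hmat" where
  "hmat_pos_adj t M = map_mat (hq_pos_adj t) (transpose_mat M)"

lemma hmat_pos_adj_dims [simp]:
  "dim_row (hmat_pos_adj t M) = dim_col M" "dim_col (hmat_pos_adj t M) = dim_row M"
  by (simp_all add: hmat_pos_adj_def)

lemma hmat_pos_adj_index [simp]:
  "i < dim_col M \<Longrightarrow> j < dim_row M \<Longrightarrow> hmat_pos_adj t M $$ (i, j) = hq_pos_adj t (M $$ (j, i))"
  by (simp add: hmat_pos_adj_def)

lemma hq_pos_adj_mult:
  assumes "t \<noteq> 0"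
  shows "hq_pos_adj t (hq_mult t p q) = hq_mult t (hq_pos_adj t q) (hq_pos_adj t p)"
  using assms by (simp add: hq_pos_adj_def hq_mult_def sgn_if algebra_simps)

lemma hq_pos_adj_sum: "hq_pos_adj t (sum f S) = (\<Sum>k\<in>S. hq_pos_adj t (f k))"
proof -
  have "hq_pos_adj t 0 = 0" "hq_pos_adj t (p + q) = hq_pos_adj t p + hq_pos_adj t q" for p q
    by (simp_all add: hq_pos_adj_def zero_prod_def algebra_simps)
  then show ?thesis by (induction S rule: infinite_finite_induct) simp_all
qed

lemma hmat_pos_adj_mult:
  "t \<noteq> 0 \<Longrightarrow> dim_col P = dim_row Q \<Longrightarrow>
     hmat_pos_adj t (P \<odot>\<^bsub>t\<^esub> Q) = hmat_pos_adj t Q \<odot>\<^bsub>t\<^esub> hmat_pos_adj t P"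
  by (rule eq_matI) (simp_all add: hq_pos_adj_sum hq_pos_adj_mult)

definition hmat_re_trace :: "hmat \<Rightarrow> real" where
  "hmat_re_trace M = (\<Sum>i<dim_row M. Re (fst (M $$ (i, i))))"

lemma Re_mult_pos_adj:
  "Re (fst (hq_mult t q (hq_pos_adj t q))) = (norm (fst q))\<^sup>2 + \<bar>t\<bar> * (norm (snd q))\<^sup>2"
  unfolding cmod_power2
  by (simp add: hq_mult_def hq_pos_adj_def abs_if sgn_if power2_eq_square algebra_simps)

lemma re_trace_square:
  "hmat_re_trace (M \<odot>\<^bsub>t\<^esub> hmat_pos_adj t M) = (\<Sum>i<dim_row M. \<Sum>k<dim_col M.
     (norm (fst (M $$ (i, k))))\<^sup>2 + \<bar>t\<bar> * (norm (snd (M $$ (i, k))))\<^sup>2)"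
  by (simp add: hmat_re_trace_def fst_sum Re_mult_pos_adj)

lemma re_trace_square_nonneg: "0 \<le> hmat_re_trace (M \<odot>\<^bsub>t\<^esub> hmat_pos_adj t M)"
  unfolding re_trace_square by (intro sum_nonneg) simp

lemma re_trace_square_eq_0:
  assumes "t \<noteq> 0" and z: "hmat_re_trace (M \<odot>\<^bsub>t\<^esub> hmat_pos_adj t M) = 0"
  shows "M = 0\<^sub>m (dim_row M) (dim_col M)"
proof (rule eq_matI)
  fix i k assume "i < dim_row (0\<^sub>m (dim_row M) (dim_col M) :: hmat)"
    "k < dim_col (0\<^sub>m (dim_row M) (dim_col M) :: hmat)"
  then have ik: "i < dim_row M" "k < dim_col M" by simp_all
  let ?f = "\<lambda>i k. (norm (fst (M $$ (i, k))))\<^sup>2 + \<bar>t\<bar> * (norm (snd (M $$ (i, k))))\<^sup>2"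
  have "(\<Sum>k<dim_col M. ?f i k) = 0"
    using z ik(1) unfolding re_trace_square
    by (subst (asm) sum_nonneg_eq_0_iff) (simp_all add: sum_nonneg)
  then have "?f i k = 0"
    using ik(2) by (subst (asm) sum_nonneg_eq_0_iff) simp_all
  then have "fst (M $$ (i, k)) = 0 \<and> snd (M $$ (i, k)) = 0"
    using assms(1) by (subst (asm) add_nonneg_eq_0_iff) simp_all
  then show "M $$ (i, k) = 0\<^sub>m (dim_row M) (dim_col M) $$ (i, k)"
    using ik by (simp add: prod_eq_iff)
qed simp_all

text \<open>The sum of the products \<open>W k (V k)\<^sup>\<sigma>\<close> over \<open>k < K\<close>, where \<open>\<sigma>\<close> is the positive involution. It
  is a recursion because the zero of matrix addition depends on the dimensions.\<close>

primrec hgram :: "real \<Rightarrow> (nat \<Rightarrow> hmat) \<Rightarrow> (nat \<Rightarrow> hmat) \<Rightarrow> nat \<Rightarrow> hmat" where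
  "hgram t W V 0 = 0\<^sub>m (dim_row (W 0)) (dim_row (V 0))"
| "hgram t W V (Suc K) = hgram t W V K + W K \<odot>\<^bsub>t\<^esub> hmat_pos_adj t (V K)"

lemma hgram_dims:
  assumes "\<And>k. W k \<in> carrier_mat a n" "\<And>k. V k \<in> carrier_mat b n"
  shows "dim_row (hgram t W V K) = a" "dim_col (hgram t W V K) = b"
  using assms by (induction K) (auto dest: carrier_matD)

lemma hgram_mult_left:
  assumes W: "\<And>k. W k \<in> carrier_mat a n" and V: "\<And>k. V k \<in> carrier_mat b n"
    and P: "P \<in> carrier_mat c a"
  shows "P \<odot>\<^bsub>t\<^esub> hgram t W V K = hgram t (\<lambda>k. P \<odot>\<^bsub>t\<^esub> W k) V K"
proof (induction K)
  case 0
  show ?case using carrier_matD[OF W[of 0]] carrier_matD[OF P] by simp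
next
  case (Suc K)
  have "P \<odot>\<^bsub>t\<^esub> hgram t W V (Suc K) =
      P \<odot>\<^bsub>t\<^esub> hgram t W V K + P \<odot>\<^bsub>t\<^esub> (W K \<odot>\<^bsub>t\<^esub> hmat_pos_adj t (V K))"
    using carrier_matD[OF W[of K]] carrier_matD[OF V[of K]] carrier_matD[OF P]
      hgram_dims[OF W V, where t = t and K = K]
    by (simp add: hmat_mult_add_right)
  also have "\<dots> = hgram t (\<lambda>k. P \<odot>\<^bsub>t\<^esub> W k) V (Suc K)"
    using carrier_matD[OF W[of K]] carrier_matD[OF P] Suc by (simp add: hmat_mult_assoc)
  finally show ?case .
qed

text \<open>The real trace of \<open>M (\<Sum> W k (W k)\<^sup>\<sigma>) M\<^sup>\<sigma>\<close> is the sum of the nonnegative real traces of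
  \<open>(M W k) (M W k)\<^sup>\<sigma>\<close>, so all of them vanish with it.\<close>

lemma hgram_left_kernel:
  assumes t: "t \<noteq> 0" and W: "\<And>k. W k \<in> carrier_mat N n" and M: "M \<in> carrier_mat m N"
    and z: "M \<odot>\<^bsub>t\<^esub> hgram t W W K = 0\<^sub>m m N" and k: "k < K"
  shows "M \<odot>\<^bsub>t\<^esub> W k = 0\<^sub>m m n"
proof -
  let ?V = "\<lambda>k. M \<odot>\<^bsub>t\<^esub> W k"
  have V: "dim_row (?V k) = m" "dim_col (?V k) = n" "dim_row (W k) = N" "dim_col (W k) = n" for k
    using carrier_matD[OF W[of k]] carrier_matD[OF M] by simp_all
  have trace: "hmat_re_trace (hgram t ?V W K \<odot>\<^bsub>t\<^esub> hmat_pos_adj t M) =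
      (\<Sum>k<K. hmat_re_trace (?V k \<odot>\<^bsub>t\<^esub> hmat_pos_adj t (?V k)))" for K
  proof (induction K)
    case 0
    show ?case using V M by (simp add: hmat_re_trace_def)
  next
    case (Suc K)
    have dims: "dim_row (hgram t ?V W K) = m" "dim_col (hgram t ?V W K) = N"
      using hgram_dims[of ?V m n W N t K] W M by auto
    have "hgram t ?V W (Suc K) \<odot>\<^bsub>t\<^esub> hmat_pos_adj t M =
        hgram t ?V W K \<odot>\<^bsub>t\<^esub> hmat_pos_adj t M + ?V K \<odot>\<^bsub>t\<^esub> hmat_pos_adj t (?V K)"
      using V M dims t
      by (simp add: hmat_mult_add_left hmat_mult_assoc hmat_pos_adj_mult)
    then show ?case
      using V M dims Suc by (simp add: hmat_re_trace_def sum.distrib del: hmat_index(1))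
  qed
  have "hgram t ?V W K = 0\<^sub>m m N" using hgram_mult_left[OF W W M, where t = t and K = K] z by simp
  then have "(\<Sum>k<K. hmat_re_trace (?V k \<odot>\<^bsub>t\<^esub> hmat_pos_adj t (?V k))) = 0"
    unfolding trace[symmetric] using M by (simp add: hmat_re_trace_def)
  then have "hmat_re_trace (?V k \<odot>\<^bsub>t\<^esub> hmat_pos_adj t (?V k)) = 0"
    using k by (subst (asm) sum_nonneg_eq_0_iff) (simp_all add: re_trace_square_nonneg)
  from re_trace_square_eq_0[OF t this] show ?thesis using V by simp
qed

lemma hpoly_mult_eq_0:
  assumes A: "A \<in> carrier_mat N N" and X: "X \<in> carrier_mat N n" and M: "M \<in> carrier_mat m N"
    and "\<And>k. k < length cs \<Longrightarrow> M \<odot>\<^bsub>t\<^esub> (hmat_pow t A k \<odot>\<^bsub>t\<^esub> X) = 0\<^sub>m m n"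
  shows "M \<odot>\<^bsub>t\<^esub> (hpoly t A cs \<odot>\<^bsub>t\<^esub> X) = 0\<^sub>m m n"
  using assms(4)
proof (induction cs rule: rev_induct)
  case Nil
  show ?case using A X M by simp
next
  case (snoc c cs)
  have "M \<odot>\<^bsub>t\<^esub> (hpoly t A (cs @ [c]) \<odot>\<^bsub>t\<^esub> X) = M \<odot>\<^bsub>t\<^esub> (hpoly t A cs \<odot>\<^bsub>t\<^esub> X) +
      hmat_scaleR c (M \<odot>\<^bsub>t\<^esub> (hmat_pow t A (length cs) \<odot>\<^bsub>t\<^esub> X))"
    unfolding hpoly_snoc[OF A] using A X M by (simp add: hmat_mult_simps)
  then show ?case using snoc by simp
qed

text \<open>From the degree \<open>K\<close> of an annihilating polynomial on, every power of \<open>A\<close> is a combination of the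
  \<open>K\<close> preceding ones. It matters that \<open>K\<close> does not depend on \<open>M\<close>: it is the length of the
  Gram sum by which all \<open>M\<close> are tested.\<close>

lemma finitely_many_powers_suffice:
  assumes A: "A \<in> carrier_mat N N"
  shows "\<exists>K. \<forall>m n. \<forall>M \<in> carrier_mat m N. \<forall>B \<in> carrier_mat N n.
    (\<forall>k<K. M \<odot>\<^bsub>t\<^esub> (hmat_pow t A k \<odot>\<^bsub>t\<^esub> B) = 0\<^sub>m m n) \<longrightarrow>
    (\<forall>k. M \<odot>\<^bsub>t\<^esub> (hmat_pow t A k \<odot>\<^bsub>t\<^esub> B) = 0\<^sub>m m n)"
proof -
  obtain cs c where c: "c \<noteq> 0" and z: "hpoly t A (cs @ [c]) = 0\<^sub>m N N"
    using annihilating_polynomial[OF A] by metis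
  show ?thesis
  proof (intro exI[of _ "length cs"] allI ballI impI)
    fix m n k and M B :: hmat
    assume M: "M \<in> carrier_mat m N" and B: "B \<in> carrier_mat N n"
      and small: "\<forall>k<length cs. M \<odot>\<^bsub>t\<^esub> (hmat_pow t A k \<odot>\<^bsub>t\<^esub> B) = 0\<^sub>m m n"
    show "M \<odot>\<^bsub>t\<^esub> (hmat_pow t A k \<odot>\<^bsub>t\<^esub> B) = 0\<^sub>m m n"
    proof (induction k rule: less_induct)
      case (less k)
      show ?case
      proof (cases "k < length cs")
        case False
        define l where "l = k - length cs"
        have k: "k = length cs + l" using False by (simp add: l_def)
        define X where "X = hmat_pow t A l \<odot>\<^bsub>t\<^esub> B"
        have X: "X \<in> carrier_mat N n" using A B by (simp add: X_def)
        have pow: "hmat_pow t A i \<odot>\<^bsub>t\<^esub> X = hmat_pow t A (i + l) \<odot>\<^bsub>t\<^esub> B" for i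
          using A B by (simp add: X_def hmat_pow_add[OF A] hmat_mult_assoc)
        have "M \<odot>\<^bsub>t\<^esub> (hpoly t A cs \<odot>\<^bsub>t\<^esub> X) = 0\<^sub>m m n"
          by (intro hpoly_mult_eq_0[OF A X M]) (simp add: pow less k)
        moreover have "M \<odot>\<^bsub>t\<^esub> (hpoly t A (cs @ [c]) \<odot>\<^bsub>t\<^esub> X) =
            M \<odot>\<^bsub>t\<^esub> (hpoly t A cs \<odot>\<^bsub>t\<^esub> X) +
            hmat_scaleR c (M \<odot>\<^bsub>t\<^esub> (hmat_pow t A (length cs) \<odot>\<^bsub>t\<^esub> X))"
          unfolding hpoly_snoc[OF A] using A X M by (simp add: hmat_mult_simps)
        ultimately have "0\<^sub>m m n = 0\<^sub>m m n +
            hmat_scaleR c (M \<odot>\<^bsub>t\<^esub> (hmat_pow t A k \<odot>\<^bsub>t\<^esub> B))"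
          using z X M by (simp add: pow k)
        then have "hmat_scaleR (inverse c) (0\<^sub>m m n) = hmat_scaleR (inverse c)
            (hmat_scaleR c (M \<odot>\<^bsub>t\<^esub> (hmat_pow t A k \<odot>\<^bsub>t\<^esub> B)))"
          using M B by simp
        then show ?thesis using c by simp
      qed (use small in simp)
    qed
  qed
qed

text \<open>Controllability makes the Gram matrix \<open>G = \<Sum> (A\<^sup>k B) (A\<^sup>k B)\<^sup>\<sigma>\<close> invertible, since \<open>M G = 0\<close>
  implies \<open>M A\<^sup>k B = 0\<close> for all \<open>k\<close>. For \<open>S = (\<Sum> (A'\<^sup>k B') (A\<^sup>k B)\<^sup>\<sigma>) G\<^sup>-\<^sup>1\<close> the equality of
  moments gives \<open>C' A'\<^sup>l S = C A\<^sup>l\<close> for all \<open>l\<close>. The required equations hold after multiplication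
  by each \<open>C' A'\<^sup>l\<close> from the left, and \<open>cancel\<close>, the observability of the second system, removes
  these factors.\<close>

lemma intertwiner_exists:
  assumes t: "t \<noteq> 0" and A: "A \<in> carrier_mat N N" and B: "B \<in> carrier_mat N n"
    and C: "C \<in> carrier_mat n N" and A': "A' \<in> carrier_mat N' N'" and B': "B' \<in> carrier_mat N' n"
    and C': "C' \<in> carrier_mat n N'" and ctrl: "controllable t n N A B"
    and cancel: "\<And>m M. M \<in> carrier_mat N' m \<Longrightarrow>
      (\<And>k. C' \<odot>\<^bsub>t\<^esub> (hmat_pow t A' k \<odot>\<^bsub>t\<^esub> M) = 0\<^sub>m n m) \<Longrightarrow> M = 0\<^sub>m N' m"
    and moments: "\<And>k. C \<odot>\<^bsub>t\<^esub> (hmat_pow t A k \<odot>\<^bsub>t\<^esub> B) = C' \<odot>\<^bsub>t\<^esub> (hmat_pow t A' k \<odot>\<^bsub>t\<^esub> B')"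
  obtains S where "S \<in> carrier_mat N' N" "S \<odot>\<^bsub>t\<^esub> A = A' \<odot>\<^bsub>t\<^esub> S" "S \<odot>\<^bsub>t\<^esub> B = B'" "C' \<odot>\<^bsub>t\<^esub> S = C"
proof -
  obtain K where K: "\<And>M m. M \<in> carrier_mat m N \<Longrightarrow>
    (\<forall>k<K. M \<odot>\<^bsub>t\<^esub> (hmat_pow t A k \<odot>\<^bsub>t\<^esub> B) = 0\<^sub>m m n) \<Longrightarrow>
    (\<forall>k. M \<odot>\<^bsub>t\<^esub> (hmat_pow t A k \<odot>\<^bsub>t\<^esub> B) = 0\<^sub>m m n)"
    using finitely_many_powers_suffice[OF A, of t] B by blast
  define W where "W k = hmat_pow t A k \<odot>\<^bsub>t\<^esub> B" for k
  define W' where "W' k = hmat_pow t A' k \<odot>\<^bsub>t\<^esub> B'" for k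
  have W: "W k \<in> carrier_mat N n" and W': "W' k \<in> carrier_mat N' n" for k
    using A B A' B' by (simp_all add: W_def W'_def)
  define G where "G = hgram t W W K"
  have G: "G \<in> carrier_mat N N" using hgram_dims[OF W W] by (auto simp: G_def)
  have "hpoly t G cs = 0\<^sub>m N N" if "G \<odot>\<^bsub>t\<^esub> hpoly t G cs = 0\<^sub>m N N" for cs
  proof -
    have "hpoly t G cs \<odot>\<^bsub>t\<^esub> hgram t W W K = 0\<^sub>m N N"
      using that hpoly_commute[OF G] by (simp add: G_def)
    from hgram_left_kernel[OF t W hpoly_carrier[OF G] this]
    have "hpoly t G cs \<odot>\<^bsub>t\<^esub> (hmat_pow t A k \<odot>\<^bsub>t\<^esub> B) = 0\<^sub>m N n" for k
      using K[OF hpoly_carrier[OF G]] by (simp add: W_def)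
    then show ?thesis by (rule controllable_left_cancel[OF ctrl A B hpoly_carrier[OF G]])
  qed
  then obtain Gi where inv: "hmat_is_inverse t G Gi"
    using inverse_if_no_nilpotent_part[OF G, of t] by metis
  then have Gi: "Gi \<in> carrier_mat N N" "G \<odot>\<^bsub>t\<^esub> Gi = hmat_one N"
    using hmat_is_inverseD[OF _ G] by auto
  define S where "S = hgram t W' W K \<odot>\<^bsub>t\<^esub> Gi"
  have gram: "hgram t W' W K \<in> carrier_mat N' N" using hgram_dims[OF W' W] by auto
  have S: "S \<in> carrier_mat N' N" using gram Gi by (simp add: S_def)
  have key: "C' \<odot>\<^bsub>t\<^esub> (hmat_pow t A' l \<odot>\<^bsub>t\<^esub> S) = C \<odot>\<^bsub>t\<^esub> hmat_pow t A l" for l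
  proof -
    let ?O' = "C' \<odot>\<^bsub>t\<^esub> hmat_pow t A' l" and ?O = "C \<odot>\<^bsub>t\<^esub> hmat_pow t A l"
    have O: "?O \<in> carrier_mat n N" "?O' \<in> carrier_mat n N'" using A C A' C' by simp_all
    have "?O' \<odot>\<^bsub>t\<^esub> W' k = ?O \<odot>\<^bsub>t\<^esub> W k" for k
      using moments[of "l + k"] A B C A' B' C'
      by (simp add: W_def W'_def hmat_pow_add[OF A] hmat_pow_add[OF A'] hmat_mult_assoc)
    then have "?O' \<odot>\<^bsub>t\<^esub> hgram t W' W K = ?O \<odot>\<^bsub>t\<^esub> G"
      unfolding G_def hgram_mult_left[OF W' W O(2)] hgram_mult_left[OF W W O(1)] by simp
    then have "(?O' \<odot>\<^bsub>t\<^esub> hgram t W' W K) \<odot>\<^bsub>t\<^esub> Gi = ?O \<odot>\<^bsub>t\<^esub> (G \<odot>\<^bsub>t\<^esub> Gi)"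
      using A C G Gi(1) by (simp add: hmat_mult_assoc)
    then show ?thesis
      using A C A' C' gram by (simp add: Gi(2) S_def hmat_mult_assoc)
  qed
  show ?thesis
  proof (rule that[OF S])
    show "S \<odot>\<^bsub>t\<^esub> A = A' \<odot>\<^bsub>t\<^esub> S"
    proof (rule hmat_diff_eq_0)
      show "S \<odot>\<^bsub>t\<^esub> A - A' \<odot>\<^bsub>t\<^esub> S = 0\<^sub>m N' N"
      proof (rule cancel)
        fix l
        have "C' \<odot>\<^bsub>t\<^esub> (hmat_pow t A' l \<odot>\<^bsub>t\<^esub> (S \<odot>\<^bsub>t\<^esub> A - A' \<odot>\<^bsub>t\<^esub> S)) =
            (C' \<odot>\<^bsub>t\<^esub> (hmat_pow t A' l \<odot>\<^bsub>t\<^esub> S)) \<odot>\<^bsub>t\<^esub> A - C' \<odot>\<^bsub>t\<^esub> (hmat_pow t A' (Suc l) \<odot>\<^bsub>t\<^esub> S)"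
          using A A' C' S by (simp add: hmat_mult_assoc hmat_mult_diff_right)
        also have "\<dots> = 0\<^sub>m n N"
          unfolding key using A C by (simp add: hmat_mult_assoc)
        finally show "C' \<odot>\<^bsub>t\<^esub> (hmat_pow t A' l \<odot>\<^bsub>t\<^esub> (S \<odot>\<^bsub>t\<^esub> A - A' \<odot>\<^bsub>t\<^esub> S)) = 0\<^sub>m n N" .
      qed (use A A' S in simp_all)
    qed (use A A' S in simp_all)
    show "S \<odot>\<^bsub>t\<^esub> B = B'"
    proof (rule hmat_diff_eq_0)
      show "S \<odot>\<^bsub>t\<^esub> B - B' = 0\<^sub>m N' n"
      proof (rule cancel)
        fix l
        have "C' \<odot>\<^bsub>t\<^esub> (hmat_pow t A' l \<odot>\<^bsub>t\<^esub> (S \<odot>\<^bsub>t\<^esub> B - B')) =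
            (C' \<odot>\<^bsub>t\<^esub> (hmat_pow t A' l \<odot>\<^bsub>t\<^esub> S)) \<odot>\<^bsub>t\<^esub> B - C' \<odot>\<^bsub>t\<^esub> (hmat_pow t A' l \<odot>\<^bsub>t\<^esub> B')"
          using B B' A' C' S by (simp add: hmat_mult_assoc hmat_mult_diff_right)
        also have "\<dots> = 0\<^sub>m n n"
          unfolding key moments[symmetric] using A B C by (simp add: hmat_mult_assoc)
        finally show "C' \<odot>\<^bsub>t\<^esub> (hmat_pow t A' l \<odot>\<^bsub>t\<^esub> (S \<odot>\<^bsub>t\<^esub> B - B')) = 0\<^sub>m n n" .
      qed (use B B' S in simp_all)
    qed (use B B' S in simp_all)
    show "C' \<odot>\<^bsub>t\<^esub> S = C" using key[of 0] A C A' C' S by simp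
  qed
qed

text \<open>Two intertwiners that agree on \<open>B\<close> agree on \<open>A\<^sup>k B\<close>, because \<open>S A\<^sup>k B = A'\<^sup>k S B\<close>.\<close>

lemma intertwiner_unique:
  assumes A: "A \<in> carrier_mat N N" and B: "B \<in> carrier_mat N n" and A': "A' \<in> carrier_mat N' N'"
    and S: "S \<in> carrier_mat N' N" and T: "T \<in> carrier_mat N' N"
    and ctrl: "controllable t n N A B"
    and SA: "S \<odot>\<^bsub>t\<^esub> A = A' \<odot>\<^bsub>t\<^esub> S" and TA: "T \<odot>\<^bsub>t\<^esub> A = A' \<odot>\<^bsub>t\<^esub> T" and eq: "S \<odot>\<^bsub>t\<^esub> B = T \<odot>\<^bsub>t\<^esub> B"
  shows "S = T"
proof (rule hmat_diff_eq_0)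
  show "S - T = 0\<^sub>m N' N"
  proof (rule controllable_left_cancel[OF ctrl A B])
    have pow: "R \<odot>\<^bsub>t\<^esub> (hmat_pow t A k \<odot>\<^bsub>t\<^esub> B) = hmat_pow t A' k \<odot>\<^bsub>t\<^esub> (R \<odot>\<^bsub>t\<^esub> B)"
      if R: "R \<in> carrier_mat N' N" and RA: "R \<odot>\<^bsub>t\<^esub> A = A' \<odot>\<^bsub>t\<^esub> R" for R k
    proof (induction k)
      case (Suc k)
      have "R \<odot>\<^bsub>t\<^esub> (hmat_pow t A (Suc k) \<odot>\<^bsub>t\<^esub> B) = (R \<odot>\<^bsub>t\<^esub> A) \<odot>\<^bsub>t\<^esub> (hmat_pow t A k \<odot>\<^bsub>t\<^esub> B)"
        unfolding hmat_pow_Suc_left[OF A] using A R by (simp add: hmat_mult_assoc)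
      also have "\<dots> = A' \<odot>\<^bsub>t\<^esub> (R \<odot>\<^bsub>t\<^esub> (hmat_pow t A k \<odot>\<^bsub>t\<^esub> B))"
        unfolding RA using A' R by (simp add: hmat_mult_assoc)
      also have "\<dots> = hmat_pow t A' (Suc k) \<odot>\<^bsub>t\<^esub> (R \<odot>\<^bsub>t\<^esub> B)"
        unfolding hmat_pow_Suc_left[OF A'] Suc using A' by (simp add: hmat_mult_assoc)
      finally show ?case .
    qed (use A A' B R in simp)
    show "(S - T) \<odot>\<^bsub>t\<^esub> (hmat_pow t A k \<odot>\<^bsub>t\<^esub> B) = 0\<^sub>m N' n" for k
      using A B A' S T by (simp add: hmat_mult_diff_left pow[OF S SA] pow[OF T TA] eq)
  qed (use S T in simp_all)
qed (use S T in simp_all)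

section \<open>The symmetry in terms of moments\<close>

lemma transfer_function_eq_Some:
  assumes A: "A \<in> carrier_mat N N" and B: "B \<in> carrier_mat N n" and C: "C \<in> carrier_mat n N"
  shows "transfer_function t A B C D x = Some Y \<longleftrightarrow>
    (\<exists>X. hmat_is_inverse t (hpencil A x) X \<and> Y = D + hmat_scaleR x (C \<odot>\<^bsub>t\<^esub> (X \<odot>\<^bsub>t\<^esub> B)))"
proof -
  have "C \<odot>\<^bsub>t\<^esub> hmat_inv t (hpencil A x) \<odot>\<^bsub>t\<^esub> B = C \<odot>\<^bsub>t\<^esub> (X \<odot>\<^bsub>t\<^esub> B)"
    if "hmat_is_inverse t (hpencil A x) X" for X
    using hmat_inv_eqI[OF that] hmat_is_inverseD(1)[OF that hpencil_carrier[OF A]] C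
    by (simp add: hmat_mult_assoc)
  then show ?thesis
    unfolding transfer_function_def hmat_invertible_def by auto metis
qed

text \<open>The inverse of \<open>I - A / x = - (1 / x) A (I - x E)\<close>. It turns values of \<open>\<phi>\<close> near infinity into values
  near the origin of a system with state matrix \<open>E\<close>.\<close>

lemma hpencil_reciprocal_inverse:
  assumes A: "A \<in> carrier_mat N N" and E: "hmat_is_inverse t A E"
    and R: "hmat_is_inverse t (hpencil E x) R" and x: "x \<noteq> 0"
  shows "hmat_is_inverse t (hpencil A (1 / x)) (hmat_scaleR (- x) (R \<odot>\<^bsub>t\<^esub> E))"
proof -
  note E' = hmat_is_inverseD[OF E A]
  note R' = hmat_is_inverseD[OF R hpencil_carrier[OF E'(1)]]
  have left: "hpencil A (1 / x) = hmat_scaleR (- 1 / x) (A \<odot>\<^bsub>t\<^esub> hpencil E x)"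
    using A E' x by (intro eq_matI)
      (simp_all add: hmat_mult_diff_right hmat_mult_scaleR_right scaleR_diff_right del: hmat_index(1))
  have right: "hpencil A (1 / x) = hmat_scaleR (- 1 / x) (hpencil E x \<odot>\<^bsub>t\<^esub> A)"
    using A E' x by (intro eq_matI)
      (simp_all add: hmat_mult_diff_left hmat_mult_scaleR_left scaleR_diff_right del: hmat_index(1))
  have "hpencil A (1 / x) \<odot>\<^bsub>t\<^esub> hmat_scaleR (- x) (R \<odot>\<^bsub>t\<^esub> E) =
      A \<odot>\<^bsub>t\<^esub> ((hpencil E x \<odot>\<^bsub>t\<^esub> R) \<odot>\<^bsub>t\<^esub> E)"
    unfolding left using A E'(1) R'(1) x
    by (simp add: hmat_mult_scaleR_left hmat_mult_scaleR_right hmat_mult_assoc)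
  moreover have "hmat_scaleR (- x) (R \<odot>\<^bsub>t\<^esub> E) \<odot>\<^bsub>t\<^esub> hpencil A (1 / x) =
      R \<odot>\<^bsub>t\<^esub> hpencil E x"
  proof -
    have "R \<odot>\<^bsub>t\<^esub> (E \<odot>\<^bsub>t\<^esub> (A \<odot>\<^bsub>t\<^esub> hpencil E x)) = R \<odot>\<^bsub>t\<^esub> ((E \<odot>\<^bsub>t\<^esub> A) \<odot>\<^bsub>t\<^esub> hpencil E x)"
      using A E'(1) by (simp add: hmat_mult_assoc)
    then show ?thesis
      unfolding left using A E' R'(1) x
      by (simp add: hmat_mult_scaleR_left hmat_mult_scaleR_right hmat_mult_assoc)
  qed
  ultimately show ?thesis
    using A E' R' by (intro hmat_is_inverseI[of _ N]) simp_all
qed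

text \<open>One step of the comparison of two expansions in powers of \<open>x\<close>: the constant terms agree in
  the limit \<open>x \<rightarrow> 0\<close>, and after division by \<open>x\<close> the bounded remainders agree.\<close>

lemma compare_constant_terms:
  assumes "\<epsilon> > 0" and V: "V \<in> carrier_mat a b" and W: "W \<in> carrier_mat a b"
    and F: "\<And>x. 0 < x \<Longrightarrow> x < \<epsilon> \<Longrightarrow> F x \<in> carrier_mat a b"
    and G: "\<And>x. 0 < x \<Longrightarrow> x < \<epsilon> \<Longrightarrow> G x \<in> carrier_mat a b"
    and eq: "\<And>x. 0 < x \<Longrightarrow> x < \<epsilon> \<Longrightarrow> V + hmat_scaleR x (F x) = W + hmat_scaleR x (G x)"
    and bd: "\<And>x. 0 < x \<Longrightarrow> x < \<epsilon> \<Longrightarrow> hnorm (F x) \<le> K" "\<And>x. 0 < x \<Longrightarrow> x < \<epsilon> \<Longrightarrow> hnorm (G x) \<le> L"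
  shows "V = W" "\<And>x. 0 < x \<Longrightarrow> x < \<epsilon> \<Longrightarrow> F x = G x"
proof -
  have entry: "V $$ (i, j) + x *\<^sub>R F x $$ (i, j) = W $$ (i, j) + x *\<^sub>R G x $$ (i, j)"
    if "0 < x" "x < \<epsilon>" "i < a" "j < b" for x i j
  proof -
    have "(V + hmat_scaleR x (F x)) $$ (i, j) = (W + hmat_scaleR x (G x)) $$ (i, j)"
      using eq that by simp
    then show ?thesis using F[OF that(1,2)] G[OF that(1,2)] V W that by simp
  qed
  have "hnorm (V - W) \<le> x * (L + K)" if x: "0 < x" "x < \<epsilon>" for x
  proof -
    have "V - W = hmat_scaleR x (G x - F x)"
    proof (rule eq_matI)
      fix i j assume "i < dim_row (hmat_scaleR x (G x - F x))" "j < dim_col (hmat_scaleR x (G x - F x))"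
      then have ij: "i < a" "j < b" using F[OF x] by simp_all
      then show "(V - W) $$ (i, j) = hmat_scaleR x (G x - F x) $$ (i, j)"
        using entry[OF x ij] F[OF x] G[OF x] V W by (simp add: algebra_simps)
    qed (use F[OF x] G[OF x] V W in simp_all)
    moreover have "hnorm (G x - F x) \<le> L + K"
      using hnorm_triangle4[of "G x" "F x"] F[OF x] G[OF x] bd[OF x] by simp
    ultimately show ?thesis using x by (simp add: mult_left_mono)
  qed
  from hmat_eq_0_if_small[OF \<open>\<epsilon> > 0\<close> this] have "V - W = 0\<^sub>m a b" using W by simp
  then show VW: "V = W" using V W by (rule hmat_diff_eq_0)
  show "F x = G x" if x: "0 < x" "x < \<epsilon>" for x
  proof (rule eq_matI)
    fix i j assume "i < dim_row (G x)" "j < dim_col (G x)"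
    then have "i < a" "j < b" using G[OF x] by simp_all
    then show "F x $$ (i, j) = G x $$ (i, j)"
      using entry[OF x, of i j] x VW by simp
  qed (use F[OF x] G[OF x] in simp_all)
qed

lemma hnorm_sandwich:
  assumes "dim_col P = dim_row R" "dim_col R = dim_row Q" "hnorm R \<le> K"
  shows "hnorm (P \<odot>\<^bsub>t\<^esub> (R \<odot>\<^bsub>t\<^esub> Q)) \<le>
    (3 + \<bar>t\<bar>) * (hnorm P * ((3 + \<bar>t\<bar>) * (K * hnorm Q)))"
proof -
  have "hnorm (R \<odot>\<^bsub>t\<^esub> Q) \<le> (3 + \<bar>t\<bar>) * (hnorm R * hnorm Q)"
    using assms by (intro hnorm_mult) simp
  also have "\<dots> \<le> (3 + \<bar>t\<bar>) * (K * hnorm Q)"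
    using assms by (intro mult_left_mono mult_right_mono) simp_all
  finally have "hnorm P * hnorm (R \<odot>\<^bsub>t\<^esub> Q) \<le> hnorm P * ((3 + \<bar>t\<bar>) * (K * hnorm Q))"
    by (rule mult_left_mono) simp
  then have "(3 + \<bar>t\<bar>) * (hnorm P * hnorm (R \<odot>\<^bsub>t\<^esub> Q)) \<le>
      (3 + \<bar>t\<bar>) * (hnorm P * ((3 + \<bar>t\<bar>) * (K * hnorm Q)))"
    by (rule mult_left_mono) simp
  with hnorm_mult[of P "R \<odot>\<^bsub>t\<^esub> Q" t] assms show ?thesis by simp
qed

text \<open>With \<open>R = (I - x A)\<^sup>-\<^sup>1\<close> and \<open>Q = (I - x E)\<^sup>-\<^sup>1\<close> the symmetry reads
  \<open>D + D\<^sup>\<circledast> + x C R B = (C Q E B)\<^sup>\<circledast>\<close>. The identities \<open>R = I + x A R\<close> and \<open>Q = I + x Q E\<close> expand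
  both sides in powers of \<open>x\<close> with bounded remainders, and the coefficients are compared one by
  one. The shift by \<open>2\<close> in the exponent has two sources: the right side starts with \<open>C E B\<close>, and
  the left side has the factor \<open>x\<close> in front of \<open>C R B\<close>.\<close>

lemma moments_of_symmetric_function:
  assumes A: "A \<in> carrier_mat N N" and B: "B \<in> carrier_mat N n" and C: "C \<in> carrier_mat n N"
    and D: "D \<in> carrier_mat n n" and E: "hmat_is_inverse t A E"
    and sym: "\<And>x X Y. x \<noteq> 0 \<Longrightarrow> hmat_is_inverse t (hpencil A x) X \<Longrightarrow>
      hmat_is_inverse t (hpencil A (1 / x)) Y \<Longrightarrow>
      D + hmat_scaleR x (C \<odot>\<^bsub>t\<^esub> (X \<odot>\<^bsub>t\<^esub> B)) =
      - ((D + hmat_scaleR (1 / x) (C \<odot>\<^bsub>t\<^esub> (Y \<odot>\<^bsub>t\<^esub> B)))\<^sup>\<circledast>)"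
  shows "D + D\<^sup>\<circledast> = (C \<odot>\<^bsub>t\<^esub> (E \<odot>\<^bsub>t\<^esub> B))\<^sup>\<circledast>"
    and "C \<odot>\<^bsub>t\<^esub> (hmat_pow t A k \<odot>\<^bsub>t\<^esub> B) = (C \<odot>\<^bsub>t\<^esub> (hmat_pow t E (k + 2) \<odot>\<^bsub>t\<^esub> B))\<^sup>\<circledast>"
proof -
  note E' = hmat_is_inverseD[OF E A]
  obtain \<epsilon>1 K1 where \<epsilon>1: "\<epsilon>1 > 0"
    and r1: "\<And>x. \<bar>x\<bar> < \<epsilon>1 \<Longrightarrow>
      \<exists>r cs. hmat_is_inverse t (hpencil A x) (hmat_scaleR r (hpoly t (hpencil A x) cs))"
    and b1: "\<And>x X. \<bar>x\<bar> < \<epsilon>1 \<Longrightarrow> hmat_is_inverse t (hpencil A x) X \<Longrightarrow> hnorm X \<le> K1"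
    using resolvent_near_origin[OF A, of t] by metis
  obtain \<epsilon>2 K2 where \<epsilon>2: "\<epsilon>2 > 0"
    and r2: "\<And>x. \<bar>x\<bar> < \<epsilon>2 \<Longrightarrow>
      \<exists>r cs. hmat_is_inverse t (hpencil E x) (hmat_scaleR r (hpoly t (hpencil E x) cs))"
    and b2: "\<And>x X. \<bar>x\<bar> < \<epsilon>2 \<Longrightarrow> hmat_is_inverse t (hpencil E x) X \<Longrightarrow> hnorm X \<le> K2"
    using resolvent_near_origin[OF E'(1), of t] by metis
  define \<epsilon> where "\<epsilon> = min \<epsilon>1 \<epsilon>2"
  have \<epsilon>: "\<epsilon> > 0" using \<epsilon>1 \<epsilon>2 by (simp add: \<epsilon>_def)
  have small: "\<bar>x\<bar> < \<epsilon>1" "\<bar>x\<bar> < \<epsilon>2" if "0 < x" "x < \<epsilon>" for x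
    using that by (simp_all add: \<epsilon>_def)
  obtain R where R: "\<And>x. 0 < x \<Longrightarrow> x < \<epsilon> \<Longrightarrow> hmat_is_inverse t (hpencil A x) (R x)"
  proof -
    have "\<exists>X. hmat_is_inverse t (hpencil A x) X" if "0 < x" "x < \<epsilon>" for x
      using r1[OF small(1)[OF that]] by blast
    with that show ?thesis by metis
  qed
  obtain Q where Q: "\<And>x. 0 < x \<Longrightarrow> x < \<epsilon> \<Longrightarrow> hmat_is_inverse t (hpencil E x) (Q x)"
  proof -
    have "\<exists>X. hmat_is_inverse t (hpencil E x) X" if "0 < x" "x < \<epsilon>" for x
      using r2[OF small(2)[OF that]] by blast
    with that show ?thesis by metis
  qed
  have R_carrier: "R x \<in> carrier_mat N N" and R_eq: "R x = hmat_one N + hmat_scaleR x (A \<odot>\<^bsub>t\<^esub> R x)"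
    if x: "0 < x" "x < \<epsilon>" for x
  proof -
    note R' = hmat_is_inverseD[OF R[OF x] hpencil_carrier[OF A]]
    show "R x \<in> carrier_mat N N" by (rule R'(1))
    have one: "R x - hmat_scaleR x (A \<odot>\<^bsub>t\<^esub> R x) = hmat_one N"
      using R'(1,2) A by (simp add: hmat_mult_diff_left hmat_mult_scaleR_left)
    show "R x = hmat_one N + hmat_scaleR x (A \<odot>\<^bsub>t\<^esub> R x)"
      unfolding one[symmetric] using R'(1) A by (intro eq_matI) (simp_all del: hmat_index(1))
  qed
  have Q_carrier: "Q x \<in> carrier_mat N N" and Q_eq: "Q x = hmat_one N + hmat_scaleR x (Q x \<odot>\<^bsub>t\<^esub> E)"
    if x: "0 < x" "x < \<epsilon>" for x
  proof -
    note Q' = hmat_is_inverseD[OF Q[OF x] hpencil_carrier[OF E'(1)]]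
    show "Q x \<in> carrier_mat N N" by (rule Q'(1))
    have one: "Q x - hmat_scaleR x (Q x \<odot>\<^bsub>t\<^esub> E) = hmat_one N"
      using Q'(1,3) E'(1) by (simp add: hmat_mult_diff_right hmat_mult_scaleR_right)
    show "Q x = hmat_one N + hmat_scaleR x (Q x \<odot>\<^bsub>t\<^esub> E)"
      unfolding one[symmetric] using Q'(1) E'(1) by (intro eq_matI) (simp_all del: hmat_index(1))
  qed
  \<comment> \<open>The remainders of the two expansions after the first \<open>k\<close> terms.\<close>
  define F where "F k x = (C \<odot>\<^bsub>t\<^esub> hmat_pow t A k) \<odot>\<^bsub>t\<^esub> (R x \<odot>\<^bsub>t\<^esub> B)" for k x
  define G where "G k x = C \<odot>\<^bsub>t\<^esub> (Q x \<odot>\<^bsub>t\<^esub> (hmat_pow t E k \<odot>\<^bsub>t\<^esub> B))" for k x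
  have F_step: "F k x = C \<odot>\<^bsub>t\<^esub> (hmat_pow t A k \<odot>\<^bsub>t\<^esub> B) + hmat_scaleR x (F (Suc k) x)"
    if x: "0 < x" "x < \<epsilon>" for k x
    unfolding F_def using A B C R_carrier[OF x]
    by (subst R_eq[OF x]) (simp add: hmat_mult_simps)
  have G_step: "G k x = C \<odot>\<^bsub>t\<^esub> (hmat_pow t E k \<odot>\<^bsub>t\<^esub> B) + hmat_scaleR x (G (Suc k) x)"
    if x: "0 < x" "x < \<epsilon>" for k x
    unfolding G_def hmat_pow_Suc_left[OF E'(1)] using B C E'(1) Q_carrier[OF x]
    by (subst Q_eq[OF x]) (simp add: hmat_mult_simps)
  have F_carrier: "F k x \<in> carrier_mat n n" and G_dims: "dim_row (G k x) = n" "dim_col (G k x) = n"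
    for k x
    using B C by (simp_all add: F_def G_def)
  then have G_carrier: "(G k x)\<^sup>\<circledast> \<in> carrier_mat n n" for k x by simp
  have F_bound: "\<exists>K. \<forall>x. 0 < x \<longrightarrow> x < \<epsilon> \<longrightarrow> hnorm (F k x) \<le> K" for k
  proof (intro exI allI impI)
    fix x assume x: "0 < x" "x < \<epsilon>"
    show "hnorm (F k x) \<le>
        (3 + \<bar>t\<bar>) * (hnorm (C \<odot>\<^bsub>t\<^esub> hmat_pow t A k) * ((3 + \<bar>t\<bar>) * (K1 * hnorm B)))"
      unfolding F_def using A B R_carrier[OF x] b1[OF small(1)[OF x] R[OF x]]
      by (intro hnorm_sandwich) simp_all
  qed
  have G_bound: "\<exists>K. \<forall>x. 0 < x \<longrightarrow> x < \<epsilon> \<longrightarrow> hnorm ((G k x)\<^sup>\<circledast>) \<le> K" for k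
  proof (intro exI allI impI)
    fix x assume x: "0 < x" "x < \<epsilon>"
    show "hnorm ((G k x)\<^sup>\<circledast>) \<le>
        (3 + \<bar>t\<bar>) * (hnorm C * ((3 + \<bar>t\<bar>) * (K2 * hnorm (hmat_pow t E k \<odot>\<^bsub>t\<^esub> B))))"
      unfolding G_def hnorm_adj using C E'(1) Q_carrier[OF x] b2[OF small(2)[OF x] Q[OF x]]
      by (intro hnorm_sandwich) simp_all
  qed
  have G_step': "(G k x)\<^sup>\<circledast> = (C \<odot>\<^bsub>t\<^esub> (hmat_pow t E k \<odot>\<^bsub>t\<^esub> B))\<^sup>\<circledast> + hmat_scaleR x ((G (Suc k) x)\<^sup>\<circledast>)"
    if x: "0 < x" "x < \<epsilon>" for k x
    using B C by (subst G_step[OF x]) (simp add: hmat_adj_add G_def)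
  have start: "(D + D\<^sup>\<circledast>) + hmat_scaleR x (F 0 x) =
      (C \<odot>\<^bsub>t\<^esub> (E \<odot>\<^bsub>t\<^esub> B))\<^sup>\<circledast> + hmat_scaleR x ((G 2 x)\<^sup>\<circledast>)" if x: "0 < x" "x < \<epsilon>" for x
  proof -
    have "D + hmat_scaleR x (F 0 x) = D + hmat_scaleR x (C \<odot>\<^bsub>t\<^esub> (R x \<odot>\<^bsub>t\<^esub> B))"
      using A C by (simp add: F_def)
    also have "\<dots> = - ((D + hmat_scaleR (1 / x)
        (C \<odot>\<^bsub>t\<^esub> (hmat_scaleR (- x) (Q x \<odot>\<^bsub>t\<^esub> E) \<odot>\<^bsub>t\<^esub> B)))\<^sup>\<circledast>)"
      using x by (intro sym R hpencil_reciprocal_inverse[OF A E] Q) simp_all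
    also have "hmat_scaleR (1 / x) (C \<odot>\<^bsub>t\<^esub> (hmat_scaleR (- x) (Q x \<odot>\<^bsub>t\<^esub> E) \<odot>\<^bsub>t\<^esub> B)) =
        hmat_scaleR (- 1) (G 1 x)"
      using x C Q_carrier[OF x] E'(1)
      by (simp add: G_def hmat_mult_scaleR_left hmat_mult_scaleR_right hmat_mult_assoc)
    finally have eq: "D + hmat_scaleR x (F 0 x) = - ((D + hmat_scaleR (- 1) (G 1 x))\<^sup>\<circledast>)" .
    have "(D + D\<^sup>\<circledast>) + hmat_scaleR x (F 0 x) = (G 1 x)\<^sup>\<circledast>"
    proof (rule eq_matI)
      fix i j assume "i < dim_row ((G 1 x)\<^sup>\<circledast>)" "j < dim_col ((G 1 x)\<^sup>\<circledast>)"
      then have ij: "i < n" "j < n" using G_dims by simp_all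
      have "(D + hmat_scaleR x (F 0 x)) $$ (i, j) = (- ((D + hmat_scaleR (- 1) (G 1 x))\<^sup>\<circledast>)) $$ (i, j)"
        by (simp only: eq)
      then show "((D + D\<^sup>\<circledast>) + hmat_scaleR x (F 0 x)) $$ (i, j) = (G 1 x)\<^sup>\<circledast> $$ (i, j)"
        using ij D F_carrier[of 0 x] G_dims[of 1 x] by (simp add: algebra_simps)
    qed (use D F_carrier[of 0 x] G_dims[of 1 x] in simp_all)
    also have "\<dots> = (C \<odot>\<^bsub>t\<^esub> (E \<odot>\<^bsub>t\<^esub> B))\<^sup>\<circledast> + hmat_scaleR x ((G 2 x)\<^sup>\<circledast>)"
      using G_step'[OF x, of 1] E'(1) by (simp add: numeral_2_eq_2)
    finally show ?thesis .
  qed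
  obtain K0 L0 where "\<And>x. 0 < x \<Longrightarrow> x < \<epsilon> \<Longrightarrow> hnorm (F 0 x) \<le> K0"
    "\<And>x. 0 < x \<Longrightarrow> x < \<epsilon> \<Longrightarrow> hnorm ((G 2 x)\<^sup>\<circledast>) \<le> L0"
    using F_bound G_bound by metis
  note base = compare_constant_terms[OF \<epsilon> _ _ F_carrier G_carrier start this]
  show "D + D\<^sup>\<circledast> = (C \<odot>\<^bsub>t\<^esub> (E \<odot>\<^bsub>t\<^esub> B))\<^sup>\<circledast>" using D B C by (intro base(1)) simp_all
  have step: "C \<odot>\<^bsub>t\<^esub> (hmat_pow t A k \<odot>\<^bsub>t\<^esub> B) = (C \<odot>\<^bsub>t\<^esub> (hmat_pow t E (k + 2) \<odot>\<^bsub>t\<^esub> B))\<^sup>\<circledast> \<and>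
      (\<forall>x. 0 < x \<longrightarrow> x < \<epsilon> \<longrightarrow> F (Suc k) x = (G (Suc (k + 2)) x)\<^sup>\<circledast>)"
    if FG: "\<And>x. 0 < x \<Longrightarrow> x < \<epsilon> \<Longrightarrow> F k x = (G (k + 2) x)\<^sup>\<circledast>" for k
  proof -
    obtain K L where bounds: "\<And>x. 0 < x \<Longrightarrow> x < \<epsilon> \<Longrightarrow> hnorm (F (Suc k) x) \<le> K"
      "\<And>x. 0 < x \<Longrightarrow> x < \<epsilon> \<Longrightarrow> hnorm ((G (Suc (k + 2)) x)\<^sup>\<circledast>) \<le> L"
      using F_bound G_bound by metis
    have eq: "C \<odot>\<^bsub>t\<^esub> (hmat_pow t A k \<odot>\<^bsub>t\<^esub> B) + hmat_scaleR x (F (Suc k) x) =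
        (C \<odot>\<^bsub>t\<^esub> (hmat_pow t E (k + 2) \<odot>\<^bsub>t\<^esub> B))\<^sup>\<circledast> + hmat_scaleR x ((G (Suc (k + 2)) x)\<^sup>\<circledast>)"
      if x: "0 < x" "x < \<epsilon>" for x
      using FG[OF x] unfolding F_step[OF x, of k] G_step'[OF x, of "k + 2"] .
    note cmp = compare_constant_terms[OF \<epsilon> _ _ F_carrier G_carrier eq bounds]
    show ?thesis using B C cmp by simp
  qed
  have "\<forall>x. 0 < x \<longrightarrow> x < \<epsilon> \<longrightarrow> F k x = (G (k + 2) x)\<^sup>\<circledast>" for k
  proof (induction k)
    case 0
    show ?case using base(2) D B C by (simp add: numeral_2_eq_2)
  next
    case (Suc k)
    then show ?case using step[of k] by simp
  qed
  then show "C \<odot>\<^bsub>t\<^esub> (hmat_pow t A k \<odot>\<^bsub>t\<^esub> B) = (C \<odot>\<^bsub>t\<^esub> (hmat_pow t E (k + 2) \<odot>\<^bsub>t\<^esub> B))\<^sup>\<circledast>"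
    using step[of k] by blast
qed

section \<open>The associated matrix\<close>

text \<open>Multiplication by \<open>H\<close> from the left removes the inverses from the conditions. Two of them then say
  that \<open>H\<close> intertwines \<open>A\<close> with \<open>E\<^sup>\<circledast>\<close> and \<open>B\<close> with \<open>E\<^sup>\<circledast> C\<^sup>\<circledast>\<close>.\<close>

lemma associated_matrix_iff:
  assumes A: "A \<in> carrier_mat N N" and B: "B \<in> carrier_mat N n" and C: "C \<in> carrier_mat n N"
    and E: "hmat_is_inverse t A E"
  shows "associated_matrix t N A B C D H \<longleftrightarrow>
    H \<in> carrier_mat N N \<and> hmat_invertible t H \<and> H = H\<^sup>\<circledast> \<and> H \<odot>\<^bsub>t\<^esub> A = E\<^sup>\<circledast> \<odot>\<^bsub>t\<^esub> H \<and>
    D + D\<^sup>\<circledast> = B\<^sup>\<circledast> \<odot>\<^bsub>t\<^esub> (H \<odot>\<^bsub>t\<^esub> B) \<and> H \<odot>\<^bsub>t\<^esub> B = E\<^sup>\<circledast> \<odot>\<^bsub>t\<^esub> C\<^sup>\<circledast>"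
proof (cases "H \<in> carrier_mat N N \<and> hmat_invertible t H")
  case True
  then have H: "H \<in> carrier_mat N N" by simp
  from True obtain L where L: "hmat_is_inverse t H L" unfolding hmat_invertible_def by blast
  note L' = hmat_is_inverseD[OF L H] and E' = hmat_is_inverseD[OF E A]
  have LH: "L \<odot>\<^bsub>t\<^esub> (H \<odot>\<^bsub>t\<^esub> X) = X" and HL: "H \<odot>\<^bsub>t\<^esub> (L \<odot>\<^bsub>t\<^esub> X) = X" if "dim_row X = N" for X
    using L' H that by (simp_all flip: hmat_mult_assoc)
  have inv: "hmat_inv t H = L" "hmat_inv t (A\<^sup>\<circledast>) = E\<^sup>\<circledast>"
    using hmat_inv_eqI[OF L] hmat_inv_eqI[OF hmat_is_inverse_adj[OF E]] by simp_all
  have A_iff: "A = L \<odot>\<^bsub>t\<^esub> E\<^sup>\<circledast> \<odot>\<^bsub>t\<^esub> H \<longleftrightarrow> H \<odot>\<^bsub>t\<^esub> A = E\<^sup>\<circledast> \<odot>\<^bsub>t\<^esub> H"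
  proof
    assume *: "A = L \<odot>\<^bsub>t\<^esub> E\<^sup>\<circledast> \<odot>\<^bsub>t\<^esub> H"
    have "H \<odot>\<^bsub>t\<^esub> (L \<odot>\<^bsub>t\<^esub> E\<^sup>\<circledast> \<odot>\<^bsub>t\<^esub> H) = E\<^sup>\<circledast> \<odot>\<^bsub>t\<^esub> H"
      using H L' E' HL[of "E\<^sup>\<circledast> \<odot>\<^bsub>t\<^esub> H"] by (simp add: hmat_mult_assoc)
    then show "H \<odot>\<^bsub>t\<^esub> A = E\<^sup>\<circledast> \<odot>\<^bsub>t\<^esub> H" by (simp only: *[symmetric])
  next
    assume "H \<odot>\<^bsub>t\<^esub> A = E\<^sup>\<circledast> \<odot>\<^bsub>t\<^esub> H"
    then have "L \<odot>\<^bsub>t\<^esub> (E\<^sup>\<circledast> \<odot>\<^bsub>t\<^esub> H) = A" using LH[of A] A by simp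
    then show "A = L \<odot>\<^bsub>t\<^esub> E\<^sup>\<circledast> \<odot>\<^bsub>t\<^esub> H" using L' E' by (simp add: hmat_mult_assoc)
  qed
  have B_iff: "B = A \<odot>\<^bsub>t\<^esub> L \<odot>\<^bsub>t\<^esub> C\<^sup>\<circledast> \<longleftrightarrow> H \<odot>\<^bsub>t\<^esub> B = E\<^sup>\<circledast> \<odot>\<^bsub>t\<^esub> C\<^sup>\<circledast>"
    if HA: "H \<odot>\<^bsub>t\<^esub> A = E\<^sup>\<circledast> \<odot>\<^bsub>t\<^esub> H"
  proof -
    have "H \<odot>\<^bsub>t\<^esub> (A \<odot>\<^bsub>t\<^esub> L \<odot>\<^bsub>t\<^esub> C\<^sup>\<circledast>) = (H \<odot>\<^bsub>t\<^esub> A) \<odot>\<^bsub>t\<^esub> (L \<odot>\<^bsub>t\<^esub> C\<^sup>\<circledast>)"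
      using H A L' by (simp add: hmat_mult_assoc)
    also have "\<dots> = E\<^sup>\<circledast> \<odot>\<^bsub>t\<^esub> C\<^sup>\<circledast>"
      unfolding HA using H E' HL[of "C\<^sup>\<circledast>"] C by (simp add: hmat_mult_assoc)
    finally have HALC: "H \<odot>\<^bsub>t\<^esub> (A \<odot>\<^bsub>t\<^esub> L \<odot>\<^bsub>t\<^esub> C\<^sup>\<circledast>) = E\<^sup>\<circledast> \<odot>\<^bsub>t\<^esub> C\<^sup>\<circledast>" .
    show ?thesis
    proof
      assume "H \<odot>\<^bsub>t\<^esub> B = E\<^sup>\<circledast> \<odot>\<^bsub>t\<^esub> C\<^sup>\<circledast>"
      then have "L \<odot>\<^bsub>t\<^esub> (H \<odot>\<^bsub>t\<^esub> B) = L \<odot>\<^bsub>t\<^esub> (H \<odot>\<^bsub>t\<^esub> (A \<odot>\<^bsub>t\<^esub> L \<odot>\<^bsub>t\<^esub> C\<^sup>\<circledast>))"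
        by (simp only: HALC)
      then show "B = A \<odot>\<^bsub>t\<^esub> L \<odot>\<^bsub>t\<^esub> C\<^sup>\<circledast>"
        using LH[of B] LH[of "A \<odot>\<^bsub>t\<^esub> L \<odot>\<^bsub>t\<^esub> C\<^sup>\<circledast>"] A B by simp
    next
      assume "B = A \<odot>\<^bsub>t\<^esub> L \<odot>\<^bsub>t\<^esub> C\<^sup>\<circledast>"
      then show "H \<odot>\<^bsub>t\<^esub> B = E\<^sup>\<circledast> \<odot>\<^bsub>t\<^esub> C\<^sup>\<circledast>" using HALC by (simp only:)
    qed
  qed
  have "B\<^sup>\<circledast> \<odot>\<^bsub>t\<^esub> H \<odot>\<^bsub>t\<^esub> B = B\<^sup>\<circledast> \<odot>\<^bsub>t\<^esub> (H \<odot>\<^bsub>t\<^esub> B)" using B H by (simp add: hmat_mult_assoc)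
  then show ?thesis unfolding associated_matrix_def inv using A_iff B_iff by metis
qed (auto simp: associated_matrix_def)

text \<open>The intertwiner of \<open>(C, A, B)\<close> and \<open>(B\<^sup>\<circledast> E\<^sup>\<circledast>, E\<^sup>\<circledast>, E\<^sup>\<circledast> C\<^sup>\<circledast>)\<close> is self-adjoint by uniqueness. It is
  invertible because \<open>S M = 0\<close> implies \<open>C A\<^sup>k M = B\<^sup>\<circledast> E\<^sup>\<circledast> (E\<^sup>\<circledast>)\<^sup>k S M = 0\<close> for all \<open>k\<close>, hence
  \<open>M = 0\<close>.\<close>

lemma associated_matrix_exists:
  assumes t: "t \<noteq> 0" and A: "A \<in> carrier_mat N N" and B: "B \<in> carrier_mat N n"
    and C: "C \<in> carrier_mat n N" and E: "hmat_is_inverse t A E"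
    and obs: "observable t n N C A" and ctrl: "controllable t n N A B"
    and const: "D + D\<^sup>\<circledast> = (C \<odot>\<^bsub>t\<^esub> (E \<odot>\<^bsub>t\<^esub> B))\<^sup>\<circledast>"
    and moments: "\<And>k. C \<odot>\<^bsub>t\<^esub> (hmat_pow t A k \<odot>\<^bsub>t\<^esub> B) = (C \<odot>\<^bsub>t\<^esub> (hmat_pow t E (k + 2) \<odot>\<^bsub>t\<^esub> B))\<^sup>\<circledast>"
  shows "\<exists>H. associated_matrix t N A B C D H"
proof -
  note E' = hmat_is_inverseD[OF E A]
  let ?A = "E\<^sup>\<circledast>" and ?B = "E\<^sup>\<circledast> \<odot>\<^bsub>t\<^esub> C\<^sup>\<circledast>" and ?C = "B\<^sup>\<circledast> \<odot>\<^bsub>t\<^esub> E\<^sup>\<circledast>"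
  have carriers: "?A \<in> carrier_mat N N" "?B \<in> carrier_mat N n" "?C \<in> carrier_mat n N"
    using B C E' by simp_all
  have EA: "E \<odot>\<^bsub>t\<^esub> (A \<odot>\<^bsub>t\<^esub> X) = X" and AE: "A \<odot>\<^bsub>t\<^esub> (E \<odot>\<^bsub>t\<^esub> X) = X" if "dim_row X = N" for X
    using E' A that by (simp_all flip: hmat_mult_assoc)
  have AE': "A\<^sup>\<circledast> \<odot>\<^bsub>t\<^esub> E\<^sup>\<circledast> = hmat_one N" "E\<^sup>\<circledast> \<odot>\<^bsub>t\<^esub> A\<^sup>\<circledast> = hmat_one N"
    using E' A by (simp_all flip: hmat_adj_mult)
  have EA_adj: "E\<^sup>\<circledast> \<odot>\<^bsub>t\<^esub> (A\<^sup>\<circledast> \<odot>\<^bsub>t\<^esub> X) = X" if "dim_row X = N" for X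
    using E' A that AE' by (simp flip: hmat_mult_assoc)
  \<comment> \<open>Observability of the second system. Taking adjoints, one has to pass from
    \<open>M\<^sup>\<circledast> E\<^sup>k E B = 0\<close> for all \<open>k\<close> to \<open>M\<^sup>\<circledast> A\<^sup>k B = 0\<close> for all \<open>k\<close>; this is possible because \<open>A\<close>, as
    the inverse of \<open>E\<close>, is a polynomial in \<open>E\<close>.\<close>
  have cancel: "M = 0\<^sub>m N m" if M: "M \<in> carrier_mat N m"
    and z: "\<And>k. ?C \<odot>\<^bsub>t\<^esub> (hmat_pow t ?A k \<odot>\<^bsub>t\<^esub> M) = 0\<^sub>m n m" for M m
  proof -
    define null where "null X \<longleftrightarrow> X \<in> carrier_mat N n \<and>
      (\<forall>k. M\<^sup>\<circledast> \<odot>\<^bsub>t\<^esub> (hmat_pow t E k \<odot>\<^bsub>t\<^esub> X) = 0\<^sub>m m n)" for X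
    have "E \<odot>\<^bsub>t\<^esub> hpoly t E cs = 0\<^sub>m N N \<Longrightarrow> hpoly t E cs = 0\<^sub>m N N" for cs
      using AE[of "hpoly t E cs"] hpoly_dims[OF E'(1)] A by simp
    then obtain r cs where "hmat_is_inverse t E (hmat_scaleR r (hpoly t E cs))"
      using inverse_if_no_nilpotent_part[OF E'(1)] by metis
    then have A_poly: "A = hmat_scaleR r (hpoly t E cs)"
      using hmat_left_right_inverse_eq[OF E'(1) A, of _ t] E' hmat_is_inverseD[OF _ E'(1)] by blast
    have null_step: "null (A \<odot>\<^bsub>t\<^esub> X)" if X: "null X" for X
    proof -
      from X have X': "X \<in> carrier_mat N n"
        and Xz: "\<And>k. M\<^sup>\<circledast> \<odot>\<^bsub>t\<^esub> (hmat_pow t E k \<odot>\<^bsub>t\<^esub> X) = 0\<^sub>m m n"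
        by (simp_all add: null_def)
      have comm: "hmat_pow t E k \<odot>\<^bsub>t\<^esub> (A \<odot>\<^bsub>t\<^esub> X) = A \<odot>\<^bsub>t\<^esub> (hmat_pow t E k \<odot>\<^bsub>t\<^esub> X)" for k
      proof (cases k)
        case (Suc l)
        have "hmat_pow t E (Suc l) \<odot>\<^bsub>t\<^esub> (A \<odot>\<^bsub>t\<^esub> X) = hmat_pow t E l \<odot>\<^bsub>t\<^esub> X"
          using A E' X' EA[of X] by (simp add: hmat_mult_assoc)
        also have "\<dots> = A \<odot>\<^bsub>t\<^esub> (hmat_pow t E (Suc l) \<odot>\<^bsub>t\<^esub> X)"
          unfolding hmat_pow_Suc_left[OF E'(1)]
          using A E' X' AE[of "hmat_pow t E l \<odot>\<^bsub>t\<^esub> X"] by (simp add: hmat_mult_assoc)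
        finally show ?thesis using Suc by simp
      qed (use A E' X' in simp)
      have "M\<^sup>\<circledast> \<odot>\<^bsub>t\<^esub> (A \<odot>\<^bsub>t\<^esub> (hmat_pow t E k \<odot>\<^bsub>t\<^esub> X)) = 0\<^sub>m m n" for k
      proof -
        have "M\<^sup>\<circledast> \<odot>\<^bsub>t\<^esub> (hpoly t E cs \<odot>\<^bsub>t\<^esub> (hmat_pow t E k \<odot>\<^bsub>t\<^esub> X)) = 0\<^sub>m m n"
        proof (rule hpoly_mult_eq_0[OF E'(1)])
          fix l
          have "hmat_pow t E l \<odot>\<^bsub>t\<^esub> (hmat_pow t E k \<odot>\<^bsub>t\<^esub> X) = hmat_pow t E (l + k) \<odot>\<^bsub>t\<^esub> X"
            using E' by (simp add: hmat_pow_add[OF E'(1)] hmat_mult_assoc)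
          then show "M\<^sup>\<circledast> \<odot>\<^bsub>t\<^esub> (hmat_pow t E l \<odot>\<^bsub>t\<^esub> (hmat_pow t E k \<odot>\<^bsub>t\<^esub> X)) = 0\<^sub>m m n"
            by (simp add: Xz)
        qed (use X' M E' in simp_all)
        then show ?thesis
          unfolding A_poly using M hpoly_dims[OF E'(1), of t cs] E'(1)
          by (simp add: hmat_mult_scaleR_left hmat_mult_scaleR_right)
      qed
      then show ?thesis using A X' by (simp add: null_def comm)
    qed
    have "null (E \<odot>\<^bsub>t\<^esub> B)"
      unfolding null_def
    proof (intro conjI allI)
      fix k
      have "(?C \<odot>\<^bsub>t\<^esub> (hmat_pow t ?A k \<odot>\<^bsub>t\<^esub> M))\<^sup>\<circledast> = M\<^sup>\<circledast> \<odot>\<^bsub>t\<^esub> (hmat_pow t E k \<odot>\<^bsub>t\<^esub> (E \<odot>\<^bsub>t\<^esub> B))"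
        using M B E' by (simp add: hmat_adj_mult hmat_mult_assoc flip: hmat_pow_adj[OF E'(1)])
      then show "M\<^sup>\<circledast> \<odot>\<^bsub>t\<^esub> (hmat_pow t E k \<odot>\<^bsub>t\<^esub> (E \<odot>\<^bsub>t\<^esub> B)) = 0\<^sub>m m n"
        using z[of k] by simp
    qed (use B E' in simp)
    from null_step[OF this] have "null B" using AE[of B] B by simp
    have "null (hmat_pow t A k \<odot>\<^bsub>t\<^esub> B)" for k
    proof (induction k)
      case (Suc k)
      have "hmat_pow t A (Suc k) \<odot>\<^bsub>t\<^esub> B = A \<odot>\<^bsub>t\<^esub> (hmat_pow t A k \<odot>\<^bsub>t\<^esub> B)"
        unfolding hmat_pow_Suc_left[OF A] using A by (simp add: hmat_mult_assoc)
      then show ?case using null_step[OF Suc] by (simp only:)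
    qed (use \<open>null B\<close> A B in simp)
    then have "M\<^sup>\<circledast> \<odot>\<^bsub>t\<^esub> (hmat_pow t E 0 \<odot>\<^bsub>t\<^esub> (hmat_pow t A k \<odot>\<^bsub>t\<^esub> B)) = 0\<^sub>m m n" for k
      unfolding null_def by blast
    then have "M\<^sup>\<circledast> \<odot>\<^bsub>t\<^esub> (hmat_pow t A k \<odot>\<^bsub>t\<^esub> B) = 0\<^sub>m m n" for k
      using A E' by simp
    then have "M\<^sup>\<circledast> = 0\<^sub>m m N"
      using controllable_left_cancel[OF ctrl A B, of "M\<^sup>\<circledast>" m] M by simp
    then have "(M\<^sup>\<circledast>)\<^sup>\<circledast> = (0\<^sub>m m N)\<^sup>\<circledast>" by (simp only:)
    then show ?thesis by simp
  qed
  have moments': "C \<odot>\<^bsub>t\<^esub> (hmat_pow t A k \<odot>\<^bsub>t\<^esub> B) = ?C \<odot>\<^bsub>t\<^esub> (hmat_pow t ?A k \<odot>\<^bsub>t\<^esub> ?B)" for k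
  proof -
    have "hmat_pow t E (k + 2) = E \<odot>\<^bsub>t\<^esub> (hmat_pow t E k \<odot>\<^bsub>t\<^esub> E)"
      using hmat_pow_Suc_left[OF E'(1), of t "Suc k"] by simp
    then show ?thesis
      unfolding moments using B C E'
      by (simp add: hmat_adj_mult hmat_mult_assoc flip: hmat_pow_adj[OF E'(1)])
  qed
  obtain S where S: "S \<in> carrier_mat N N" and SA: "S \<odot>\<^bsub>t\<^esub> A = ?A \<odot>\<^bsub>t\<^esub> S"
    and SB: "S \<odot>\<^bsub>t\<^esub> B = ?B" and CS: "?C \<odot>\<^bsub>t\<^esub> S = C"
    using intertwiner_exists[OF t A B C carriers ctrl cancel moments'] by blast
  have SA': "S\<^sup>\<circledast> \<odot>\<^bsub>t\<^esub> A = ?A \<odot>\<^bsub>t\<^esub> S\<^sup>\<circledast>"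
  proof -
    have "A\<^sup>\<circledast> \<odot>\<^bsub>t\<^esub> S\<^sup>\<circledast> = (S \<odot>\<^bsub>t\<^esub> A)\<^sup>\<circledast>" using A S by (simp add: hmat_adj_mult)
    also have "\<dots> = S\<^sup>\<circledast> \<odot>\<^bsub>t\<^esub> E" unfolding SA using E' S by (simp add: hmat_adj_mult)
    finally have "(A\<^sup>\<circledast> \<odot>\<^bsub>t\<^esub> S\<^sup>\<circledast>) \<odot>\<^bsub>t\<^esub> A = S\<^sup>\<circledast>" using A E' S by (simp add: hmat_mult_assoc)
    then have "E\<^sup>\<circledast> \<odot>\<^bsub>t\<^esub> (A\<^sup>\<circledast> \<odot>\<^bsub>t\<^esub> (S\<^sup>\<circledast> \<odot>\<^bsub>t\<^esub> A)) = E\<^sup>\<circledast> \<odot>\<^bsub>t\<^esub> S\<^sup>\<circledast>"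
      using A S by (simp add: hmat_mult_assoc)
    then show ?thesis using EA_adj[of "S\<^sup>\<circledast> \<odot>\<^bsub>t\<^esub> A"] S by simp
  qed
  have SB': "S\<^sup>\<circledast> \<odot>\<^bsub>t\<^esub> B = ?B"
  proof -
    have "C\<^sup>\<circledast> = S\<^sup>\<circledast> \<odot>\<^bsub>t\<^esub> (E \<odot>\<^bsub>t\<^esub> B)"
      using B E' S by (simp add: hmat_adj_mult flip: CS)
    then have "?B = (?A \<odot>\<^bsub>t\<^esub> S\<^sup>\<circledast>) \<odot>\<^bsub>t\<^esub> (E \<odot>\<^bsub>t\<^esub> B)" using S E' by (simp add: hmat_mult_assoc)
    also have "\<dots> = S\<^sup>\<circledast> \<odot>\<^bsub>t\<^esub> B"
      unfolding SA'[symmetric] using A S B AE[of B] by (simp add: hmat_mult_assoc)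
    finally show ?thesis by (rule sym)
  qed
  have sym: "S = S\<^sup>\<circledast>"
    using S SB SB' by (intro intertwiner_unique[OF A B carriers(1) _ _ ctrl SA SA']) simp_all
  have pow: "S \<odot>\<^bsub>t\<^esub> hmat_pow t A k = hmat_pow t ?A k \<odot>\<^bsub>t\<^esub> S" for k
  proof (induction k)
    case (Suc k)
    have "S \<odot>\<^bsub>t\<^esub> hmat_pow t A (Suc k) = (S \<odot>\<^bsub>t\<^esub> hmat_pow t A k) \<odot>\<^bsub>t\<^esub> A"
      using A S by (simp add: hmat_mult_assoc)
    also have "\<dots> = hmat_pow t ?A k \<odot>\<^bsub>t\<^esub> (S \<odot>\<^bsub>t\<^esub> A)"
      unfolding Suc using E' S by (simp add: hmat_mult_assoc)
    also have "\<dots> = hmat_pow t ?A (Suc k) \<odot>\<^bsub>t\<^esub> S"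
      unfolding SA using E' S by (simp add: hmat_mult_assoc)
    finally show ?case .
  qed (use A E' S in simp)
  have "hpoly t S cs = 0\<^sub>m N N" if z: "S \<odot>\<^bsub>t\<^esub> hpoly t S cs = 0\<^sub>m N N" for cs
  proof (rule observable_right_cancel[OF obs A C hpoly_carrier[OF S]])
    fix k
    let ?M = "hpoly t S cs"
    have "C \<odot>\<^bsub>t\<^esub> (hmat_pow t A k \<odot>\<^bsub>t\<^esub> ?M) = ?C \<odot>\<^bsub>t\<^esub> ((S \<odot>\<^bsub>t\<^esub> hmat_pow t A k) \<odot>\<^bsub>t\<^esub> ?M)"
      using A B E' S by (simp add: hmat_mult_assoc flip: CS)
    also have "\<dots> = 0\<^sub>m n N"
      unfolding pow using A B E' S z by (simp add: hmat_mult_assoc)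
    finally show "C \<odot>\<^bsub>t\<^esub> (hmat_pow t A k \<odot>\<^bsub>t\<^esub> ?M) = 0\<^sub>m n N" .
  qed
  then have "hmat_invertible t S"
    using inverse_if_no_nilpotent_part[OF S, of t] unfolding hmat_invertible_def by metis
  moreover have "D + D\<^sup>\<circledast> = B\<^sup>\<circledast> \<odot>\<^bsub>t\<^esub> (S \<odot>\<^bsub>t\<^esub> B)"
    unfolding const SB using B C E' by (simp add: hmat_adj_mult hmat_mult_assoc)
  ultimately have "associated_matrix t N A B C D S"
    unfolding associated_matrix_iff[OF A B C E] using S sym SA SB by blast
  then show ?thesis by blast
qed

text \<open>Since \<open>C = B\<^sup>\<circledast> H A\<close> and \<open>x A X = X - I\<close>, the term \<open>x C X B\<close> is \<open>B\<^sup>\<circledast> H X B - B\<^sup>\<circledast> H B\<close>, and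
  \<open>B\<^sup>\<circledast> H B = D + D\<^sup>\<circledast>\<close>. From \<open>A\<^sup>\<circledast> H = H E\<close> one obtains \<open>Y\<^sup>\<circledast> H = - x H X A\<close>, so
  \<open>(1 / x) (C Y B)\<^sup>\<circledast> = - B\<^sup>\<circledast> H X B\<close>. Both sides of the claim are therefore \<open>B\<^sup>\<circledast> H X B - D\<^sup>\<circledast>\<close>.\<close>

lemma associated_matrix_imp_symmetric:
  assumes A: "A \<in> carrier_mat N N" and B: "B \<in> carrier_mat N n" and C: "C \<in> carrier_mat n N"
    and D: "D \<in> carrier_mat n n" and E: "hmat_is_inverse t A E"
    and assoc: "associated_matrix t N A B C D H" and x: "x \<noteq> 0"
    and X: "hmat_is_inverse t (hpencil A x) X" and Y: "hmat_is_inverse t (hpencil A (1 / x)) Y"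
  shows "D + hmat_scaleR x (C \<odot>\<^bsub>t\<^esub> (X \<odot>\<^bsub>t\<^esub> B)) =
    - ((D + hmat_scaleR (1 / x) (C \<odot>\<^bsub>t\<^esub> (Y \<odot>\<^bsub>t\<^esub> B)))\<^sup>\<circledast>)"
proof -
  note E' = hmat_is_inverseD[OF E A]
    and X' = hmat_is_inverseD[OF X hpencil_carrier[OF A]]
    and Y' = hmat_is_inverseD[OF Y hpencil_carrier[OF A]]
  from assoc have H: "H \<in> carrier_mat N N" and sym: "H\<^sup>\<circledast> = H" and HA: "H \<odot>\<^bsub>t\<^esub> A = E\<^sup>\<circledast> \<odot>\<^bsub>t\<^esub> H"
    and DD: "D + D\<^sup>\<circledast> = B\<^sup>\<circledast> \<odot>\<^bsub>t\<^esub> (H \<odot>\<^bsub>t\<^esub> B)" and HB: "H \<odot>\<^bsub>t\<^esub> B = E\<^sup>\<circledast> \<odot>\<^bsub>t\<^esub> C\<^sup>\<circledast>"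
    unfolding associated_matrix_iff[OF A B C E] by simp_all
  have AE': "A\<^sup>\<circledast> \<odot>\<^bsub>t\<^esub> E\<^sup>\<circledast> = hmat_one N"
    using E' A by (simp flip: hmat_adj_mult)
  have AE_adj: "A\<^sup>\<circledast> \<odot>\<^bsub>t\<^esub> (E\<^sup>\<circledast> \<odot>\<^bsub>t\<^esub> Z) = Z" if "dim_row Z = N" for Z
    using E' A that AE' by (simp flip: hmat_mult_assoc)
  have EA: "E \<odot>\<^bsub>t\<^esub> (A \<odot>\<^bsub>t\<^esub> Z) = Z" and AE: "A \<odot>\<^bsub>t\<^esub> (E \<odot>\<^bsub>t\<^esub> Z) = Z" if "dim_row Z = N" for Z
    using E' A that by (simp_all flip: hmat_mult_assoc)
  have XA: "X - hmat_scaleR x (X \<odot>\<^bsub>t\<^esub> A) = hmat_one N"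
    using X' A by (simp add: hmat_mult_diff_right hmat_mult_scaleR_right)
  have AX: "X - hmat_scaleR x (A \<odot>\<^bsub>t\<^esub> X) = hmat_one N"
    using X' A by (simp add: hmat_mult_diff_left hmat_mult_scaleR_left)
  have comm: "X \<odot>\<^bsub>t\<^esub> A = A \<odot>\<^bsub>t\<^esub> X"
  proof (rule eq_matI)
    fix i j assume ij: "i < dim_row (A \<odot>\<^bsub>t\<^esub> X)" "j < dim_col (A \<odot>\<^bsub>t\<^esub> X)"
    have "(X - hmat_scaleR x (X \<odot>\<^bsub>t\<^esub> A)) $$ (i, j) = (X - hmat_scaleR x (A \<odot>\<^bsub>t\<^esub> X)) $$ (i, j)"
      by (simp only: XA AX)
    then show "(X \<odot>\<^bsub>t\<^esub> A) $$ (i, j) = (A \<odot>\<^bsub>t\<^esub> X) $$ (i, j)"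
      using ij A X' x by (simp del: hmat_index(1))
  qed (use A X' in simp_all)
  have AH: "A\<^sup>\<circledast> \<odot>\<^bsub>t\<^esub> H = H \<odot>\<^bsub>t\<^esub> E"
  proof -
    have "A\<^sup>\<circledast> \<odot>\<^bsub>t\<^esub> H = A\<^sup>\<circledast> \<odot>\<^bsub>t\<^esub> ((H \<odot>\<^bsub>t\<^esub> A) \<odot>\<^bsub>t\<^esub> E)"
      using A H E' by (simp add: hmat_mult_assoc)
    also have "\<dots> = H \<odot>\<^bsub>t\<^esub> E"
      unfolding HA using E' H AE_adj[of "H \<odot>\<^bsub>t\<^esub> E"] by (simp add: hmat_mult_assoc)
    finally show ?thesis .
  qed
  have C_adj: "C\<^sup>\<circledast> = H \<odot>\<^bsub>t\<^esub> (E \<odot>\<^bsub>t\<^esub> B)"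
  proof -
    have "C\<^sup>\<circledast> = A\<^sup>\<circledast> \<odot>\<^bsub>t\<^esub> (H \<odot>\<^bsub>t\<^esub> B)" unfolding HB using AE_adj[of "C\<^sup>\<circledast>"] C by simp
    also have "\<dots> = (A\<^sup>\<circledast> \<odot>\<^bsub>t\<^esub> H) \<odot>\<^bsub>t\<^esub> B" using A H by (simp add: hmat_mult_assoc)
    also have "\<dots> = H \<odot>\<^bsub>t\<^esub> (E \<odot>\<^bsub>t\<^esub> B)" unfolding AH using E' H by (simp add: hmat_mult_assoc)
    finally show ?thesis .
  qed
  have C_eq: "C = B\<^sup>\<circledast> \<odot>\<^bsub>t\<^esub> (H \<odot>\<^bsub>t\<^esub> A)"
  proof -
    have "C = (H \<odot>\<^bsub>t\<^esub> (E \<odot>\<^bsub>t\<^esub> B))\<^sup>\<circledast>" by (simp flip: C_adj)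
    then show ?thesis using B E' H by (simp add: hmat_adj_mult hmat_mult_assoc sym HA)
  qed
  have YH: "Y\<^sup>\<circledast> \<odot>\<^bsub>t\<^esub> H = hmat_scaleR (- x) (H \<odot>\<^bsub>t\<^esub> (X \<odot>\<^bsub>t\<^esub> A))"
  proof -
    let ?Z = "H \<odot>\<^bsub>t\<^esub> (X \<odot>\<^bsub>t\<^esub> A)"
    have "A\<^sup>\<circledast> \<odot>\<^bsub>t\<^esub> ?Z = (A\<^sup>\<circledast> \<odot>\<^bsub>t\<^esub> H) \<odot>\<^bsub>t\<^esub> (A \<odot>\<^bsub>t\<^esub> X)"
      unfolding comm using A H by (simp add: hmat_mult_assoc)
    also have "\<dots> = H \<odot>\<^bsub>t\<^esub> X"
      unfolding AH using E' H X' EA[of X] by (simp add: hmat_mult_assoc)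
    finally have AZ: "A\<^sup>\<circledast> \<odot>\<^bsub>t\<^esub> ?Z = H \<odot>\<^bsub>t\<^esub> X" .
    have "H = H \<odot>\<^bsub>t\<^esub> (X - hmat_scaleR x (X \<odot>\<^bsub>t\<^esub> A))" using H by (simp add: XA)
    also have "\<dots> = H \<odot>\<^bsub>t\<^esub> X - hmat_scaleR x ?Z"
      using H X'(1) A by (simp add: hmat_mult_diff_right hmat_mult_scaleR_right)
    also have "\<dots> = (hpencil A (1 / x))\<^sup>\<circledast> \<odot>\<^bsub>t\<^esub> hmat_scaleR (- x) ?Z"
      using A H X'(1) x
      by (simp add: hmat_adj_diff hmat_mult_diff_left hmat_mult_scaleR_left
          hmat_mult_scaleR_right AZ)
        (intro eq_matI; simp add: scaleR_diff_right del: hmat_index(1))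
    finally have "Y\<^sup>\<circledast> \<odot>\<^bsub>t\<^esub> H = (Y\<^sup>\<circledast> \<odot>\<^bsub>t\<^esub> (hpencil A (1 / x))\<^sup>\<circledast>) \<odot>\<^bsub>t\<^esub> hmat_scaleR (- x) ?Z"
      using Y' A by (simp add: hmat_mult_assoc)
    also have "Y\<^sup>\<circledast> \<odot>\<^bsub>t\<^esub> (hpencil A (1 / x))\<^sup>\<circledast> = hmat_one N"
      using Y' A by (simp flip: hmat_adj_mult)
    finally show ?thesis using H A by simp
  qed
  let ?T = "B\<^sup>\<circledast> \<odot>\<^bsub>t\<^esub> (H \<odot>\<^bsub>t\<^esub> (X \<odot>\<^bsub>t\<^esub> B))"
  have left: "hmat_scaleR x (C \<odot>\<^bsub>t\<^esub> (X \<odot>\<^bsub>t\<^esub> B)) = ?T - (D + D\<^sup>\<circledast>)"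
  proof -
    have "hmat_scaleR x (A \<odot>\<^bsub>t\<^esub> X) = X - hmat_one N"
      unfolding AX[symmetric] using A X' by (intro eq_matI) (simp_all del: hmat_index(1))
    moreover have "hmat_scaleR x (C \<odot>\<^bsub>t\<^esub> (X \<odot>\<^bsub>t\<^esub> B)) =
        B\<^sup>\<circledast> \<odot>\<^bsub>t\<^esub> (H \<odot>\<^bsub>t\<^esub> (hmat_scaleR x (A \<odot>\<^bsub>t\<^esub> X) \<odot>\<^bsub>t\<^esub> B))"
      unfolding C_eq using A B H X'
      by (simp add: hmat_mult_assoc hmat_mult_scaleR_left hmat_mult_scaleR_right)
    ultimately show ?thesis
      unfolding DD using B H X' by (simp add: hmat_mult_diff_left hmat_mult_diff_right)
  qed
  have right: "hmat_scaleR (1 / x) ((C \<odot>\<^bsub>t\<^esub> (Y \<odot>\<^bsub>t\<^esub> B))\<^sup>\<circledast>) = hmat_scaleR (- 1) ?T"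
  proof -
    have "(C \<odot>\<^bsub>t\<^esub> (Y \<odot>\<^bsub>t\<^esub> B))\<^sup>\<circledast> = B\<^sup>\<circledast> \<odot>\<^bsub>t\<^esub> ((Y\<^sup>\<circledast> \<odot>\<^bsub>t\<^esub> H) \<odot>\<^bsub>t\<^esub> (E \<odot>\<^bsub>t\<^esub> B))"
      using B C E' H Y' by (simp add: hmat_adj_mult C_adj hmat_mult_assoc)
    also have "\<dots> = hmat_scaleR (- x) ?T"
      unfolding YH using A B E' H X' AE[of B]
      by (simp add: hmat_mult_assoc hmat_mult_scaleR_left hmat_mult_scaleR_right)
    finally show ?thesis using x by simp
  qed
  have "(D + hmat_scaleR (1 / x) (C \<odot>\<^bsub>t\<^esub> (Y \<odot>\<^bsub>t\<^esub> B)))\<^sup>\<circledast> = D\<^sup>\<circledast> + hmat_scaleR (- 1) ?T"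
    using right D B C by (simp add: hmat_adj_add)
  then show ?thesis
    unfolding left using D B C
    by (intro eq_matI) (simp_all add: algebra_simps del: hmat_index(1))
qed

theorem theorem7p1:
  fixes t :: real and n N :: nat
    and \<phi> :: "real \<Rightarrow> hmat option"
    and A B C D :: hmat
  assumes "t \<noteq> 0"
    and "rational_at_origin t n \<phi>"
    and "regular_at_infinity n \<phi>"
    and "is_minimal_realization t n N \<phi> A B C D"
  shows "((\<forall>x X Y. x \<noteq> 0 \<and> \<phi> x = Some X \<and> \<phi> (1 / x) = Some Y \<longrightarrow> X = - (Y\<^sup>\<circledast>))
            \<longleftrightarrow> (\<exists>H. associated_matrix t N A B C D H))
         \<and> (\<forall>H H'. associated_matrix t N A B C D H \<and> associated_matrix t N A B C D H' \<longrightarrow> H = H')"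
proof -
  from assms(4) have A: "A \<in> carrier_mat N N" and B: "B \<in> carrier_mat N n"
    and C: "C \<in> carrier_mat n N" and D: "D \<in> carrier_mat n n"
    and \<phi>: "\<phi> = transfer_function t A B C D"
    and obs: "observable t n N C A" and ctrl: "controllable t n N A B"
    unfolding is_minimal_realization_def is_realization_def by blast+
  have \<phi>_Some: "\<phi> x = Some Y \<longleftrightarrow> (\<exists>X. hmat_is_inverse t (hpencil A x) X \<and>
      Y = D + hmat_scaleR x (C \<odot>\<^bsub>t\<^esub> (X \<odot>\<^bsub>t\<^esub> B)))" for x Y
    unfolding \<phi> by (rule transfer_function_eq_Some[OF A B C])
  have dims: "\<forall>x Y. \<phi> x = Some Y \<longrightarrow> Y \<in> carrier_mat n n"
  proof (intro allI impI)
    fix x Y assume "\<phi> x = Some Y"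
    then obtain X where "Y = D + hmat_scaleR x (C \<odot>\<^bsub>t\<^esub> (X \<odot>\<^bsub>t\<^esub> B))" unfolding \<phi>_Some by blast
    then show "Y \<in> carrier_mat n n" using B C D by simp
  qed
  obtain \<epsilon> K where \<epsilon>: "\<epsilon> > 0" and
    reg: "\<And>x. 0 < x \<Longrightarrow> x < \<epsilon> \<Longrightarrow> \<exists>Y. \<phi> (1 / x) = Some Y \<and> hnorm Y \<le> K"
    using regular_at_infinity_bounded[OF assms(3) dims] by blast
  have "\<exists>X. hmat_is_inverse t (hpencil A (1 / x)) X \<and>
      hnorm (hmat_scaleR (1 / x) (C \<odot>\<^bsub>t\<^esub> (X \<odot>\<^bsub>t\<^esub> B))) \<le> K + hnorm D" if x: "0 < x" "x < \<epsilon>" for x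
  proof -
    obtain Y where Y: "\<phi> (1 / x) = Some Y" "hnorm Y \<le> K" using reg[OF x] by blast
    then obtain X where X: "hmat_is_inverse t (hpencil A (1 / x)) X"
      and Y_eq: "Y = D + hmat_scaleR (1 / x) (C \<odot>\<^bsub>t\<^esub> (X \<odot>\<^bsub>t\<^esub> B))"
      unfolding \<phi>_Some by blast
    have "hmat_scaleR (1 / x) (C \<odot>\<^bsub>t\<^esub> (X \<odot>\<^bsub>t\<^esub> B)) = Y - D"
      unfolding Y_eq using B C D by (intro eq_matI) (simp_all del: hmat_index(1))
    then have "hnorm (hmat_scaleR (1 / x) (C \<odot>\<^bsub>t\<^esub> (X \<odot>\<^bsub>t\<^esub> B))) \<le> K + hnorm D"
      using hnorm_triangle4[of Y D] dims[rule_format, OF Y(1)] D Y(2) by simp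
    with X show ?thesis by blast
  qed
  then obtain E where E: "hmat_is_inverse t A E"
    using state_matrix_invertible[OF A B C obs ctrl \<epsilon>] by blast
  have "(\<forall>x X Y. x \<noteq> 0 \<and> \<phi> x = Some X \<and> \<phi> (1 / x) = Some Y \<longrightarrow> X = - (Y\<^sup>\<circledast>))
      \<longleftrightarrow> (\<exists>H. associated_matrix t N A B C D H)"
  proof
    assume sym: "\<forall>x X Y. x \<noteq> 0 \<and> \<phi> x = Some X \<and> \<phi> (1 / x) = Some Y \<longrightarrow> X = - (Y\<^sup>\<circledast>)"
    have "D + hmat_scaleR x (C \<odot>\<^bsub>t\<^esub> (X \<odot>\<^bsub>t\<^esub> B)) =
        - ((D + hmat_scaleR (1 / x) (C \<odot>\<^bsub>t\<^esub> (Y \<odot>\<^bsub>t\<^esub> B)))\<^sup>\<circledast>)"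
      if "x \<noteq> 0" "hmat_is_inverse t (hpencil A x) X" "hmat_is_inverse t (hpencil A (1 / x)) Y"
      for x X Y
      using sym[rule_format, of x] that unfolding \<phi>_Some by blast
    note moments = moments_of_symmetric_function[OF A B C D E this]
    show "\<exists>H. associated_matrix t N A B C D H"
      by (rule associated_matrix_exists[OF assms(1) A B C E obs ctrl moments])
  next
    assume "\<exists>H. associated_matrix t N A B C D H"
    then obtain H where H: "associated_matrix t N A B C D H" by blast
    show "\<forall>x X Y. x \<noteq> 0 \<and> \<phi> x = Some X \<and> \<phi> (1 / x) = Some Y \<longrightarrow> X = - (Y\<^sup>\<circledast>)"
      using associated_matrix_imp_symmetric[OF A B C D E H] unfolding \<phi>_Some by blast
  qed
  moreover have "H = H'"
    if "associated_matrix t N A B C D H" "associated_matrix t N A B C D H'" for H H'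
  proof -
    have E': "E\<^sup>\<circledast> \<in> carrier_mat N N" using hmat_is_inverseD(1)[OF E A] by simp
    from that[unfolded associated_matrix_iff[OF A B C E]]
    have H: "H \<in> carrier_mat N N" "H' \<in> carrier_mat N N"
      "H \<odot>\<^bsub>t\<^esub> A = E\<^sup>\<circledast> \<odot>\<^bsub>t\<^esub> H" "H' \<odot>\<^bsub>t\<^esub> A = E\<^sup>\<circledast> \<odot>\<^bsub>t\<^esub> H'"
      and "H \<odot>\<^bsub>t\<^esub> B = E\<^sup>\<circledast> \<odot>\<^bsub>t\<^esub> C\<^sup>\<circledast>" "H' \<odot>\<^bsub>t\<^esub> B = E\<^sup>\<circledast> \<odot>\<^bsub>t\<^esub> C\<^sup>\<circledast>"
      by blast+
    then have "H \<odot>\<^bsub>t\<^esub> B = H' \<odot>\<^bsub>t\<^esub> B" by (simp only:)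
    then show ?thesis by (rule intertwiner_unique[OF A B E' H(1,2) ctrl H(3,4)])
  qed
  ultimately show ?thesis by blast
qed

end
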